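(* Let $0<p\le1$. Let $\varphi\in C(\mathbb{R}^d)$ have a compact support and let $\widehat\varphi\in L_p(\mathbb{R}^d)$. Then $$\sup_{\varepsilon_j\ne0,\ j=1,\dots,d}\left(\prod_{j=1}^d|\varepsilon_j|\right)^{1-\frac1p}\|\Phi_\varepsilon\|_{L_p(\mathbb{T}^d)}=(2\pi)^{d/2}\|\widehat\varphi\|_{L_p(\mathbb{R}^d)},$$ where $$\Phi_\varepsilon(x)=\sum_{k\in\mathbb{Z}^d}\varphi(\varepsilon_1k_1,\dots,\varepsilon_dk_d)e^{i(k,x)},\qquad\varepsilon=(\varepsilon_1,\dots,\varepsilon_d).$$
   Context: $\mathbb{T}^d=\mathbb{R}^d/2\pi\mathbb{Z}^d$; $\|f\|_{L_p(X)}=(\int_X|f(x)|^pdx)^{1/p}$ (Lebesgue measure, not normalized). The Fourier transform is $\widehat\varphi(\xi)=\frac1{(2\pi)^{d/2}}\int_{\mathbb{R}^d}\varphi(x)e^{-i(x,\xi)}dx$. The supremum is over all $\varepsilon\in\mathbb{R}^d$ with all coordinates nonzero. *)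

theory Defs
  imports "HOL-Analysis.Analysis"
begin

definition in_Lp :: "real \<Rightarrow> 'a::euclidean_space set \<Rightarrow> ('a \<Rightarrow> complex) \<Rightarrow> bool" where
  "in_Lp p X f \<longleftrightarrow>
     set_borel_measurable lborel X f \<and> set_integrable lborel X (\<lambda>x. norm (f x) powr p)"

text \<open>Real-valued, hence only meaningful for functions satisfying \<open>in_Lp p X\<close>: the Bochner
  integral of a non-integrable function is \<open>0\<close>.\<close>

definition Lp_norm :: "real \<Rightarrow> 'a::euclidean_space set \<Rightarrow> ('a \<Rightarrow> complex) \<Rightarrow> real" where
  "Lp_norm p X f = (LINT x:X|lborel. norm (f x) powr p) powr (1 / p)"

text \<open>A function on \<open>\<real>\<^sup>d / 2\<pi>\<int>\<^sup>d\<close> is a function on \<open>\<real>\<^sup>d\<close> that is \<open>2\<pi>\<close>-periodic in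
  each coordinate; integration over the torus is integration over a fundamental domain, with
  total mass \<open>(2\<pi>)\<^sup>d\<close>.\<close>

definition torus_cell :: "(real ^ 'd) set" where
  "torus_cell = {x. \<forall>j. 0 \<le> x $ j \<and> x $ j < 2 * pi}"

definition fourier_transform :: "(real ^ 'd \<Rightarrow> complex) \<Rightarrow> real ^ 'd \<Rightarrow> complex" where
  "fourier_transform \<phi> \<xi> =
     complex_of_real (1 / (2 * pi) powr (real CARD('d) / 2))
       * (LINT x|lborel. \<phi> x * exp (- \<i> * complex_of_real (x \<bullet> \<xi>)))"

definition compact_support :: "('a::topological_space \<Rightarrow> complex) \<Rightarrow> bool" where
  "compact_support \<phi> \<longleftrightarrow> compact (closure {x. \<phi> x \<noteq> 0})"

text \<open>For compactly supported \<open>\<phi>\<close> and \<open>\<epsilon>\<close> with all coordinates nonzero, only finitely many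
  terms of this sum are nonzero.\<close>

definition Phi :: "(real ^ 'd \<Rightarrow> complex) \<Rightarrow> real ^ 'd \<Rightarrow> real ^ 'd \<Rightarrow> complex" where
  "Phi \<phi> \<epsilon> x =
     (\<Sum>\<^sub>\<infinity>k\<in>(UNIV :: (int ^ 'd) set).
        \<phi> (\<chi> j. \<epsilon> $ j * of_int (k $ j))
          * exp (\<i> * complex_of_real ((\<chi> j. of_int (k $ j)) \<bullet> x)))"

end

theory Submission
  imports Defs
begin

text \<open>
  Write \<open>C = (2\<pi>)\<^bsup>d/2\<^esup>\<close> and \<open>P = \<Prod>\<^sub>j \<bar>\<epsilon>\<^sub>j\<bar>\<close>. For the upper bound, the Poisson inequality
  \<open>\<bar>\<Sum>\<^sub>k h k\<bar> \<le> \<Sum>\<^sub>m \<bar>\<integral> h v e\<^bsup>2\<pi>i(m,v)\<^esup> dv\<bar>\<close>, applied to \<open>h v = \<phi> (\<epsilon> v) e\<^bsup>i(v,x)\<^esup>\<close>, dominates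
  \<open>\<bar>\<Phi>\<^sub>\<epsilon> x\<bar>\<close> by \<open>C / P\<close> times the sum over \<open>m\<close> of the absolute values of the Fourier transform of
  \<open>\<phi>\<close> at \<open>- (x + 2\<pi>m) / \<epsilon>\<close>. Since \<open>p \<le> 1\<close>, the \<open>p\<close>-th power may be taken termwise, and
  integrating over the torus unfolds the sum to an integral over the whole space. The inequality
  is proved by testing \<open>h\<close> against nonnegative trigonometric polynomials of mass one (whose
  coefficients are therefore at most one) concentrating on the lattice; neither Fourier inversion
  nor the pointwise Poisson formula is needed.

  For the lower bound, take \<open>\<epsilon> = (t, \<dots>, t)\<close> with \<open>t \<rightarrow> 0\<close>: the functions \<open>t\<^sup>d \<Phi>\<^sub>\<epsilon> (t \<xi>)\<close> are Riemann sums
  converging to \<open>C\<close> times the Fourier transform at \<open>- \<xi>\<close>, and Fatou's lemma applies.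
\<close>

section \<open>Lattice cells and unfolding\<close>

definition ivec :: "int ^ 'd \<Rightarrow> real ^ 'd" where
  "ivec k = (\<chi> j. of_int (k $ j))"

definition stretch :: "real ^ 'd \<Rightarrow> real ^ 'd \<Rightarrow> real ^ 'd" where
  "stretch \<epsilon> x = (\<chi> j. \<epsilon> $ j * x $ j)"

text \<open>Half-open, so that the translates of the cube by \<open>c\<close> times integer vectors
  tile the space exactly. The lower corner \<open>a\<close> stays free because cubes with a corner
  at \<open>0\<close> and cubes centred at the origin are both used.\<close>

definition cell :: "real \<Rightarrow> real \<Rightarrow> (real ^ 'd) set" where
  "cell a c = {x. \<forall>j. a \<le> x $ j \<and> x $ j < a + c}"

lemma ivec_nth [simp]: "ivec k $ j = of_int (k $ j)"
  by (simp add: ivec_def)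

lemma ivec_add: "ivec (k + l) = ivec k + ivec l"
  by (simp add: vec_eq_iff)

lemma stretch_nth [simp]: "stretch \<epsilon> x $ j = \<epsilon> $ j * x $ j"
  by (simp add: stretch_def)

lemma ivec_0 [simp]: "ivec 0 = 0"
  by (simp add: vec_eq_iff)

lemma torus_cell_eq: "torus_cell = cell 0 (2 * pi)"
  by (simp add: torus_cell_def cell_def)

lemma continuous_stretch [continuous_intros]:
  "continuous_on S f \<Longrightarrow> continuous_on S (\<lambda>x. stretch \<epsilon> (f x))"
  unfolding stretch_def by (intro continuous_intros)

lemma borel_measurable_vec_nth [measurable]:
  "(\<lambda>x :: real ^ 'd. x $ j) \<in> borel_measurable borel"
  by (intro borel_measurable_continuous_onI continuous_intros)

lemma sets_cell [measurable]: "cell a c \<in> sets borel"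
  unfolding cell_def by measurable

lemma measurable_stretch [measurable]: "stretch \<epsilon> \<in> borel_measurable borel"
  by (intro borel_measurable_continuous_onI continuous_intros)

lemma Basis_real_vec: "(Basis :: (real ^ 'd) set) = range (\<lambda>j. axis j 1)"
  by (auto simp: Basis_vec_def)

lemma prod_Basis_real_vec: "(\<Prod>b\<in>(Basis :: (real ^ 'd) set). f b) = (\<Prod>j\<in>UNIV. f (axis j 1))"
  unfolding Basis_real_vec by (subst prod.reindex) (auto simp: inj_on_def axis_eq_axis)

lemma sum_Basis_real_vec: "(\<Sum>b\<in>(Basis :: (real ^ 'd) set). f b) = (\<Sum>j\<in>UNIV. f (axis j 1))"
  unfolding Basis_real_vec by (subst sum.reindex) (auto simp: inj_on_def axis_eq_axis)

section \<open>Change of variables under a diagonal dilation\<close>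

lemma lborel_stretch:
  fixes \<epsilon> :: "real ^ 'd"
  assumes "\<And>j. \<epsilon> $ j \<noteq> 0"
  shows "lborel = density (distr lborel borel (stretch \<epsilon>)) (\<lambda>_. ennreal (\<Prod>j\<in>UNIV. \<bar>\<epsilon> $ j\<bar>))"
proof -
  have "(\<lambda>x. 0 + (\<Sum>j\<in>Basis. (\<epsilon> \<bullet> j * (x \<bullet> j)) *\<^sub>R j)) = stretch \<epsilon>"
    by (simp add: fun_eq_iff vec_eq_iff sum_Basis_real_vec inner_axis)
      (simp add: axis_def if_distrib cong: if_cong)
  moreover have "\<epsilon> \<bullet> b \<noteq> 0" if "b \<in> Basis" for b
    using that assms by (auto simp: Basis_real_vec inner_axis)
  moreover have "(\<Prod>b\<in>Basis. \<bar>\<epsilon> \<bullet> b\<bar>) = (\<Prod>j\<in>UNIV. \<bar>\<epsilon> $ j\<bar>)"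
    by (simp add: prod_Basis_real_vec inner_axis)
  ultimately show ?thesis
    using lborel_affine_euclidean[of "\<lambda>b. \<epsilon> \<bullet> b" 0] by simp
qed

lemma nn_integral_stretch:
  fixes \<epsilon> :: "real ^ 'd"
  assumes "\<And>j. \<epsilon> $ j \<noteq> 0" and [measurable]: "f \<in> borel_measurable borel"
  shows "(\<integral>\<^sup>+x. f x \<partial>lborel) = ennreal (\<Prod>j\<in>UNIV. \<bar>\<epsilon> $ j\<bar>) * (\<integral>\<^sup>+x. f (stretch \<epsilon> x) \<partial>lborel)"
  by (subst lborel_stretch[OF assms(1)])
    (simp add: nn_integral_density nn_integral_distr nn_integral_cmult)

lemma integral_stretch:
  fixes \<epsilon> :: "real ^ 'd" and f :: "real ^ 'd \<Rightarrow> complex"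
  assumes "\<And>j. \<epsilon> $ j \<noteq> 0" and [measurable]: "f \<in> borel_measurable borel"
  shows "(LINT x|lborel. f x) = of_real (\<Prod>j\<in>UNIV. \<bar>\<epsilon> $ j\<bar>) * (LINT x|lborel. f (stretch \<epsilon> x))"
  by (subst lborel_stretch[OF assms(1)])
    (simp add: integral_density integral_distr prod_nonneg scaleR_conv_of_real del: of_real_prod)

text \<open>The half-open cube lies between an open and a closed box of the same volume.\<close>

lemma emeasure_cell:
  assumes "0 \<le> c"
  shows "emeasure lborel (cell a c :: (real ^ 'd) set) = ennreal (c ^ CARD('d))"
proof (rule antisym)
  let ?l = "(\<chi> j. a) :: real ^ 'd" and ?u = "(\<chi> j. a + c) :: real ^ 'd"
  have le: "\<forall>b\<in>Basis. ?l \<bullet> b \<le> ?u \<bullet> b"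
    using assms by (simp add: Basis_real_vec inner_axis)
  have "cell a c \<subseteq> cbox ?l ?u"
    by (auto simp: cell_def mem_box_cart less_imp_le)
  then have "emeasure lborel (cell a c :: (real ^ 'd) set) \<le> emeasure lborel (cbox ?l ?u)"
    by (rule emeasure_mono) auto
  also have "\<dots> = ennreal (c ^ CARD('d))"
    using le by (simp add: emeasure_lborel_cbox_eq prod_Basis_real_vec inner_axis)
  finally show "emeasure lborel (cell a c :: (real ^ 'd) set) \<le> ennreal (c ^ CARD('d))" .
  have "box ?l ?u \<subseteq> cell a c"
    by (auto simp: cell_def mem_box_cart less_imp_le)
  then have "emeasure lborel (box ?l ?u) \<le> emeasure lborel (cell a c :: (real ^ 'd) set)"
    by (rule emeasure_mono) auto
  moreover have "emeasure lborel (box ?l ?u) = ennreal (c ^ CARD('d))"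
    using le by (simp add: emeasure_lborel_box_eq prod_Basis_real_vec inner_axis)
  ultimately show "ennreal (c ^ CARD('d)) \<le> emeasure lborel (cell a c :: (real ^ 'd) set)" by simp
qed

lemma measure_cell: "0 \<le> c \<Longrightarrow> measure lborel (cell a c :: (real ^ 'd) set) = c ^ CARD('d)"
  by (simp add: measure_def emeasure_cell)

text \<open>The tiling property in explicit form: every point lies in exactly one translate of the
  cell, and coordinatewise floors name it.\<close>

lemma mem_cell_floor:
  assumes "0 < c"
  shows "x - c *\<^sub>R ivec m \<in> cell a c \<longleftrightarrow> m = (\<chi> j. \<lfloor>(x $ j - a) / c\<rfloor>)"
proof -
  have "a \<le> x $ j - c * m $ j \<and> x $ j - c * m $ j < a + c \<longleftrightarrow> \<lfloor>(x $ j - a) / c\<rfloor> = m $ j" for j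
    using assms by (auto simp: floor_eq_iff field_simps)
  then show ?thesis by (auto simp: cell_def vec_eq_iff)
qed

lemma finite_bounded_ivec:
  "finite {k :: int ^ 'd. \<forall>j. \<bar>real_of_int (k $ j)\<bar> \<le> R}"
proof (rule finite_subset)
  let ?F = "PiE (UNIV :: 'd set) (\<lambda>_. {- \<lceil>R\<rceil>..\<lceil>R\<rceil>})"
  show "{k :: int ^ 'd. \<forall>j. \<bar>real_of_int (k $ j)\<bar> \<le> R} \<subseteq> (\<lambda>f. \<chi> j. f j) ` ?F"
  proof
    fix k :: "int ^ 'd" assume "k \<in> {k. \<forall>j. \<bar>real_of_int (k $ j)\<bar> \<le> R}"
    then have b: "\<bar>real_of_int (k $ j)\<bar> \<le> R" for j by auto
    have "k $ j \<in> {- \<lceil>R\<rceil>..\<lceil>R\<rceil>}" for j using b[of j] by (simp; linarith)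
    then show "k \<in> (\<lambda>f. \<chi> j. f j) ` ?F" by (intro image_eqI[of _ _ "\<lambda>j. k $ j"]) auto
  qed
  show "finite ((\<lambda>f. \<chi> j. f j) ` ?F)" by (intro finite_imageI finite_PiE) auto
qed

lemma nn_integral_translate:
  fixes f :: "'a :: euclidean_space \<Rightarrow> ennreal"
  assumes [measurable]: "f \<in> borel_measurable borel"
  shows "(\<integral>\<^sup>+x. f (x + t) \<partial>lborel) = (\<integral>\<^sup>+x. f x \<partial>lborel)"
proof -
  have "(\<integral>\<^sup>+x. f x \<partial>lborel) = (\<integral>\<^sup>+x. f x \<partial>distr lborel borel ((+) t))"
    by (simp add: lborel_distr_plus)
  then show ?thesis by (simp add: nn_integral_distr add.commute)
qed

text \<open>The indicators of the translated cells form a partition of unity. The sum over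
  \<open>m\<close> is an integral over \<open>count_space\<close>, so that Tonelli's theorem applies
  to it.\<close>

lemma nn_integral_count_space_cell:
  assumes c: "0 < c"
  shows "(\<integral>\<^sup>+m. indicator (cell a c) (x - c *\<^sub>R ivec m) \<partial>count_space UNIV) = 1"
    and "(\<integral>\<^sup>+m. indicator (cell a c) (x + c *\<^sub>R ivec m) \<partial>count_space UNIV) = 1"
proof -
  let ?u = "(\<chi> j. \<lfloor>(x $ j - a) / c\<rfloor>)"
  have "indicator (cell a c) (x - c *\<^sub>R ivec m) = (indicator {?u} m :: ennreal)" for m
    using mem_cell_floor[OF c, of x m a] by (auto split: split_indicator)
  then show "(\<integral>\<^sup>+m. indicator (cell a c) (x - c *\<^sub>R ivec m) \<partial>count_space UNIV) = 1"
    by (simp add: nn_integral_indicator)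
  have "indicator (cell a c) (x + c *\<^sub>R ivec m) = (indicator {- ?u} m :: ennreal)" for m
    using mem_cell_floor[OF c, of x "- m" a]
    by (auto simp: cell_def minus_equation_iff[of m] split: split_indicator)
  then show "(\<integral>\<^sup>+m. indicator (cell a c) (x + c *\<^sub>R ivec m) \<partial>count_space UNIV) = 1"
    by (simp add: nn_integral_indicator)
qed

text \<open>Insert the partition of unity, interchange sum and integral by Tonelli, and translate
  each piece back to the base cell.\<close>

lemma nn_integral_unfold:
  fixes f :: "real ^ 'd \<Rightarrow> ennreal"
  assumes c: "0 < c" and [measurable]: "f \<in> borel_measurable borel"
  shows "(\<integral>\<^sup>+x. f x \<partial>lborel) =
    (\<integral>\<^sup>+x\<in>cell a c. (\<integral>\<^sup>+m. f (x + c *\<^sub>R ivec m) \<partial>count_space UNIV) \<partial>lborel)"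
proof -
  let ?i = "indicator (cell a c) :: real ^ 'd \<Rightarrow> ennreal"
  have "(\<integral>\<^sup>+x. f x \<partial>lborel) =
      (\<integral>\<^sup>+x. (\<integral>\<^sup>+m. f x * ?i (x - c *\<^sub>R ivec m) \<partial>count_space UNIV) \<partial>lborel)"
    by (simp add: nn_integral_cmult nn_integral_count_space_cell[OF c])
  also have "\<dots> = (\<integral>\<^sup>+m. (\<integral>\<^sup>+x. f x * ?i (x - c *\<^sub>R ivec m) \<partial>lborel) \<partial>count_space UNIV)"
    by (rule nn_integral_count_space_nn_integral) auto
  also have "\<dots> = (\<integral>\<^sup>+m. (\<integral>\<^sup>+x. f (x + c *\<^sub>R ivec m) * ?i x \<partial>lborel) \<partial>count_space UNIV)"
    using nn_integral_translate[of "\<lambda>x. f x * ?i (x - c *\<^sub>R ivec m)" "c *\<^sub>R ivec m" for m]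
    by simp
  also have "\<dots> = (\<integral>\<^sup>+x. (\<integral>\<^sup>+m. f (x + c *\<^sub>R ivec m) * ?i x \<partial>count_space UNIV) \<partial>lborel)"
    by (rule nn_integral_count_space_nn_integral[symmetric]) auto
  finally show ?thesis by (simp add: nn_integral_multc)
qed

text \<open>The translation is moved onto the indicator; unfolding over the other cell then lets
  periodicity pull \<open>f\<close> out of the sum, and the remaining indicators add up to one. This
  covers both a shift of the argument (\<open>t\<close>) and a change of cell (\<open>a\<close> to
  \<open>b\<close>).\<close>

lemma nn_integral_cell_shift:
  fixes f :: "real ^ 'd \<Rightarrow> ennreal"
  assumes c: "0 < c" and [measurable]: "f \<in> borel_measurable borel"
    and per: "\<And>x m. f (x + c *\<^sub>R ivec m) = f x"
  shows "(\<integral>\<^sup>+x\<in>cell a c. f (x + t) \<partial>lborel) = (\<integral>\<^sup>+x\<in>cell b c. f x \<partial>lborel)"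
proof -
  let ?i = "indicator (cell a c) :: real ^ 'd \<Rightarrow> ennreal"
  have "(\<integral>\<^sup>+x\<in>cell a c. f (x + t) \<partial>lborel) = (\<integral>\<^sup>+x. f x * ?i (x - t) \<partial>lborel)"
    using nn_integral_translate[of "\<lambda>x. f x * ?i (x - t)" t] by simp
  also have "\<dots> = (\<integral>\<^sup>+x\<in>cell b c. f x * (\<integral>\<^sup>+m. ?i (x - t + c *\<^sub>R ivec m) \<partial>count_space UNIV) \<partial>lborel)"
    by (subst nn_integral_unfold[OF c, where a = b]) (auto simp: per nn_integral_cmult algebra_simps)
  finally show ?thesis by (simp add: nn_integral_count_space_cell[OF c])
qed

section \<open>Trigonometric polynomials\<close>

lemma integral_translate:
  fixes f :: "'a :: euclidean_space \<Rightarrow> complex"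
  assumes [measurable]: "f \<in> borel_measurable borel"
  shows "(LINT x|lborel. f (x + t)) = (LINT x|lborel. f x)"
proof -
  have "(LINT x|lborel. f x) = (LINT x|distr lborel borel ((+) t). f x)"
    by (simp add: lborel_distr_plus)
  then show ?thesis by (simp add: integral_distr add.commute)
qed

lemma integrable_compact_supp:
  fixes f :: "'a :: euclidean_space \<Rightarrow> 'b :: {banach, second_countable_topology}"
  assumes f: "continuous_on UNIV f" and s: "\<And>x. f x \<noteq> 0 \<Longrightarrow> x \<in> cbox l u"
  shows "integrable lborel f"
proof -
  have "(\<lambda>x. indicator (cbox l u) x *\<^sub>R f x) = f"
    using s by (auto simp: fun_eq_iff split: split_indicator)
  moreover have "integrable lborel (\<lambda>x. indicator (cbox l u) x *\<^sub>R f x)"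
    by (intro borel_integrable_compact continuous_on_subset[OF f]) auto
  ultimately show ?thesis by simp
qed

lemma set_integrable_cell:
  fixes f :: "real ^ 'd \<Rightarrow> 'b :: {banach, second_countable_topology}"
  assumes f: "continuous_on UNIV f"
  shows "set_integrable lborel (cell a c) f"
proof (rule set_integrable_subset)
  show "set_integrable lborel (cbox (\<chi> j. a) (\<chi> j. a + c)) f"
    unfolding set_integrable_def by (intro borel_integrable_compact continuous_on_subset[OF f]) auto
  show "cell a c \<subseteq> cbox (\<chi> j. a) (\<chi> j. a + c)"
    by (auto simp: cell_def mem_box_cart less_imp_le)
qed auto

text \<open>These characters equal \<open>1\<close> on the integer lattice and have period one in
  each coordinate; those in \<open>Phi\<close> have period \<open>2 * pi\<close>.\<close>

definition echar :: "int ^ 'd \<Rightarrow> real ^ 'd \<Rightarrow> complex" where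
  "echar m v = cis (2 * pi * (ivec m \<bullet> v))"

lemma echar_add: "echar (m + l) v = echar m v * echar l v"
  by (simp add: echar_def cis_mult ivec_add inner_add_left algebra_simps)

lemma echar_0 [simp]: "echar 0 v = 1"
  by (simp add: echar_def)

lemma norm_echar [simp]: "norm (echar m v) = 1"
  by (simp add: echar_def)

lemma echar_translate: "echar m (v + w) = echar m v * echar m w"
  by (simp add: echar_def cis_mult inner_add_right algebra_simps)

lemma echar_ivec [simp]: "echar m (ivec k) = 1"
proof -
  have "ivec m \<bullet> ivec k = of_int (\<Sum>j\<in>UNIV. m $ j * k $ j)"
    by (simp add: inner_vec_def)
  then show ?thesis by (simp add: echar_def cis_multiple_2pi del: of_int_sum)
qed

lemma continuous_echar [continuous_intros]:
  "continuous_on S f \<Longrightarrow> continuous_on S (\<lambda>x. echar m (f x))"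
  unfolding echar_def by (intro continuous_intros)

lemma measurable_echar [measurable]: "echar m \<in> borel_measurable borel"
  by (intro borel_measurable_continuous_onI continuous_intros)

text \<open>A shift by \<open>t\<close> preserves the integral over a period cell but reverses the
  sign of \<open>f\<close>. The shift lemma concerns nonnegative integrands, so it is applied to
  \<open>1 + f\<close>, which the bound on \<open>f\<close> makes nonnegative; its shift is
  \<open>1 - f\<close>.\<close>

lemma set_integral_antiperiodic_eq_0:
  fixes f :: "real ^ 'd \<Rightarrow> real"
  assumes f: "continuous_on UNIV f" and le: "\<And>v. \<bar>f v\<bar> \<le> 1"
    and per: "\<And>v k. f (v + ivec k) = f v" and anti: "\<And>v. f (v + t) = - f v"
  shows "(LINT v:cell a 1|lborel. f v) = 0"
proof -
  note [measurable] = borel_measurable_continuous_onI[OF f]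
  note [simp] = set_integrable_cell[OF f] set_integrable_cell[of "\<lambda>v. 1 :: real"]
  \<comment> \<open>The sign \<open>s\<close> treats \<open>1 + f\<close> and \<open>1 - f\<close>
    at once.\<close>
  have *: "(\<integral>\<^sup>+v\<in>cell a 1. ennreal (1 + s * f v) \<partial>lborel) = ennreal (LINT v:cell a 1|lborel. 1 + s * f v)"
    if "\<bar>s\<bar> = 1" for s
  proof -
    have "0 \<le> 1 + s * f v" for v using le[of v] that by (auto simp: abs_if split: if_splits)
    moreover have "set_integrable lborel (cell a 1) (\<lambda>v. 1 + s * f v)"
      by (intro set_integrable_cell continuous_intros f)
    ultimately show ?thesis
      unfolding set_integrable_def set_lebesgue_integral_def
      by (subst nn_integral_eq_integral[symmetric]) (auto intro!: nn_integral_cong split: split_indicator)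
  qed
  have "(\<integral>\<^sup>+v\<in>cell a 1. ennreal (1 + f (v + t)) \<partial>lborel) = (\<integral>\<^sup>+v\<in>cell a 1. ennreal (1 + f v) \<partial>lborel)"
    by (rule nn_integral_cell_shift) (auto simp: per)
  then have "ennreal (LINT v:cell a 1|lborel. 1 + (-1) * f v) = ennreal (LINT v:cell a 1|lborel. 1 + 1 * f v)"
    using *[of 1] *[of "-1"] by (simp add: anti)
  moreover have "0 \<le> (LINT v:cell a 1|lborel. 1 + s * f v)" if "\<bar>s\<bar> = 1" for s
  proof -
    have "0 \<le> 1 + s * f v" for v using le[of v] that by (auto simp: abs_if split: if_splits)
    then show ?thesis by (auto simp: set_lebesgue_integral_def intro!: integral_nonneg_AE)
  qed
  ultimately have "(LINT v:cell a 1|lborel. 1 + (-1) * f v) = (LINT v:cell a 1|lborel. 1 + 1 * f v)"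
    by (metis abs_neg_one abs_one ennreal_inj)
  then show ?thesis by simp
qed

text \<open>Orthogonality of characters. For nonzero frequency a half-period translation reverses
  the sign, so the real and imaginary parts both integrate to zero.\<close>

lemma integral_echar:
  fixes m :: "int ^ 'd"
  shows "(LINT v:cell a 1|lborel. echar m v) = (if m = 0 then 1 else 0)"
proof (cases "m = 0")
  case True
  then show ?thesis by (simp add: set_lebesgue_integral_def measure_cell scaleR_conv_of_real)
next
  case False
  then obtain j where j: "m $ j \<noteq> 0" by (auto simp: vec_eq_iff)
  \<comment> \<open>half a period in direction \<open>j\<close>\<close>
  define t :: "real ^ 'd" where "t = axis j (1 / (2 * m $ j))"
  have "echar m t = -1" using j by (simp add: echar_def t_def inner_axis)
  then have t: "echar m (v + t) = - echar m v" for v by (simp add: echar_translate)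
  have p: "echar m (v + ivec k) = echar m v" for v k by (simp add: echar_translate)
  have i: "integrable lborel (\<lambda>v. indicator (cell a 1) v *\<^sub>R echar m v)"
    using set_integrable_cell[of "echar m" a 1] unfolding set_integrable_def
    by (simp add: continuous_intros)
  have "(LINT v:cell a 1|lborel. Re (echar m v)) = 0"
    by (rule set_integral_antiperiodic_eq_0[where t = t])
      (auto intro!: continuous_intros abs_Re_le_cmod[THEN order_trans] simp: t p)
  moreover have "(LINT v:cell a 1|lborel. Im (echar m v)) = 0"
    by (rule set_integral_antiperiodic_eq_0[where t = t])
      (auto intro!: continuous_intros abs_Im_le_cmod[THEN order_trans] simp: t p)
  ultimately show ?thesis
    using integral_Re[OF i] integral_Im[OF i] False
    by (auto simp: set_lebesgue_integral_def complex_eq_iff)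
qed

text \<open>Only the existence of a finite expansion is recorded: the coefficients of the kernel
  below are estimated, never computed.\<close>

definition trig_poly :: "(real ^ 'd \<Rightarrow> complex) \<Rightarrow> bool" where
  "trig_poly f \<longleftrightarrow> (\<exists>S a. finite S \<and> (\<forall>v. f v = (\<Sum>m\<in>S. a m * echar m v)))"

lemma trig_poly_cmult:
  assumes "trig_poly f" shows "trig_poly (\<lambda>v. c * f v)"
proof -
  obtain S a where "finite S" "\<And>v. f v = (\<Sum>m\<in>S. a m * echar m v)"
    using assms by (auto simp: trig_poly_def)
  then show ?thesis unfolding trig_poly_def
    by (intro exI[of _ S] exI[of _ "\<lambda>m. c * a m"]) (simp add: sum_distrib_left mult.assoc)
qed

lemma trig_poly_echar_mult:
  assumes "trig_poly f" shows "trig_poly (\<lambda>v. echar l v * f v)"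
proof -
  obtain S a where S: "finite S" "\<And>v. f v = (\<Sum>m\<in>S. a m * echar m v)"
    using assms by (auto simp: trig_poly_def)
  have "echar l v * f v = (\<Sum>m\<in>(\<lambda>m. m + l) ` S. a (m - l) * echar m v)" for v
    by (subst sum.reindex) (auto simp: S sum_distrib_left echar_add mult_ac inj_on_def)
  with S(1) show ?thesis unfolding trig_poly_def
    by (intro exI[of _ "(\<lambda>m. m + l) ` S"] exI[of _ "\<lambda>m. a (m - l)"]) auto
qed

lemma trig_poly_add:
  assumes "trig_poly f" "trig_poly g" shows "trig_poly (\<lambda>v. f v + g v)"
proof -
  obtain S a T b where S: "finite S" "\<And>v. f v = (\<Sum>m\<in>S. a m * echar m v)"
    and T: "finite T" "\<And>v. g v = (\<Sum>m\<in>T. b m * echar m v)"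
    using assms by (auto simp: trig_poly_def)
  \<comment> \<open>Both coefficient families are extended by zero to the union of the frequency
    sets.\<close>
  let ?c = "\<lambda>m. (if m \<in> S then a m else 0) + (if m \<in> T then b m else 0)"
  have "f v = (\<Sum>m\<in>S \<union> T. (if m \<in> S then a m else 0) * echar m v)" for v
    unfolding S(2) using S(1) T(1) by (intro sum.mono_neutral_cong_left) auto
  moreover have "g v = (\<Sum>m\<in>S \<union> T. (if m \<in> T then b m else 0) * echar m v)" for v
    unfolding T(2) using S(1) T(1) by (intro sum.mono_neutral_cong_left) auto
  ultimately have "f v + g v = (\<Sum>m\<in>S \<union> T. ?c m * echar m v)" for v
    by (simp add: sum.distrib distrib_right)
  with S(1) T(1) show ?thesis unfolding trig_poly_def
    by (intro exI[of _ "S \<union> T"] exI[of _ ?c]) auto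
qed

lemma trig_poly_echar: "trig_poly (echar m)"
  unfolding trig_poly_def by (intro exI[of _ "{m}"] exI[of _ "\<lambda>_. 1"]) simp

lemma trig_poly_const: "trig_poly (\<lambda>v. c)"
  using trig_poly_cmult[OF trig_poly_echar[of 0]] by simp

lemma trig_poly_sum:
  "finite S \<Longrightarrow> (\<And>i. i \<in> S \<Longrightarrow> trig_poly (f i)) \<Longrightarrow> trig_poly (\<lambda>v. \<Sum>i\<in>S. f i v)"
  by (induction S rule: finite_induct) (auto intro: trig_poly_add trig_poly_const)

lemma trig_poly_mult:
  assumes "trig_poly f" "trig_poly g" shows "trig_poly (\<lambda>v. f v * g v)"
proof -
  obtain S a where S: "finite S" "\<And>v. f v = (\<Sum>m\<in>S. a m * echar m v)"
    using assms by (auto simp: trig_poly_def)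
  have "trig_poly (\<lambda>v. \<Sum>m\<in>S. a m * (echar m v * g v))"
    by (intro trig_poly_sum trig_poly_cmult trig_poly_echar_mult assms S)
  then show ?thesis by (simp add: S sum_distrib_right mult.assoc)
qed

lemma trig_poly_prod:
  "finite S \<Longrightarrow> (\<And>i. i \<in> S \<Longrightarrow> trig_poly (f i)) \<Longrightarrow> trig_poly (\<lambda>v. \<Prod>i\<in>S. f i v)"
  by (induction S rule: finite_induct) (auto intro: trig_poly_mult trig_poly_const)

lemma trig_poly_power: "trig_poly f \<Longrightarrow> trig_poly (\<lambda>v. f v ^ n)"
  by (induction n) (auto intro: trig_poly_mult trig_poly_const)

text \<open>By orthogonality each coefficient of \<open>K\<close> is the integral of
  \<open>K\<close> times a conjugate character over a unit cell, hence at most the integral of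
  \<open>norm (K v)\<close> there. Expanding \<open>K\<close> under the integral against
  \<open>h\<close> gives the bound, whose right-hand side may be infinite.\<close>

lemma norm_integral_mult_trig_poly_le:
  fixes h K :: "real ^ 'd \<Rightarrow> complex"
  assumes h: "integrable lborel h" and K: "trig_poly K"
  shows "ennreal (norm (LINT v|lborel. h v * K v)) \<le>
    ennreal (LINT v:cell a 1|lborel. norm (K v)) *
      (\<integral>\<^sup>+m. ennreal (norm (LINT v|lborel. h v * echar m v)) \<partial>count_space UNIV)"
proof -
  obtain S b where S: "finite S" and b: "\<And>v. K v = (\<Sum>m\<in>S. b m * echar m v)"
    using K by (auto simp: trig_poly_def)
  note [measurable] = borel_measurable_integrable[OF h]
  let ?I = "LINT v:cell a 1|lborel. norm (K v)"
  let ?H = "\<lambda>m. LINT v|lborel. h v * echar m v"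
  have K_cont: "continuous_on UNIV K"
    unfolding b by (intro continuous_intros)
  have coeff: "norm (b m) \<le> ?I" if m: "m \<in> S" for m
  proof -
    have "(LINT v:cell a 1|lborel. K v * echar (- m) v) =
        (LINT v:cell a 1|lborel. (\<Sum>l\<in>S. b l * echar (l - m) v))"
      by (simp add: b sum_distrib_right mult.assoc echar_add[symmetric])
    also have "\<dots> = (\<Sum>l\<in>S. LINT v:cell a 1|lborel. b l * echar (l - m) v)"
      unfolding set_lebesgue_integral_def scaleR_sum_right
      by (intro Bochner_Integration.integral_sum)
        (auto simp: set_integrable_def[symmetric] intro!: set_integrable_cell continuous_intros)
    also have "\<dots> = (\<Sum>l\<in>S. b l * (if l = m then 1 else 0))"
      by (simp add: integral_echar)
    also have "\<dots> = b m" using m S by (simp add: if_distrib cong: if_cong)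
    finally have "norm (b m) = norm (LINT v:cell a 1|lborel. K v * echar (- m) v)" by simp
    also have "\<dots> \<le> (LINT v:cell a 1|lborel. norm (K v * echar (- m) v))"
      by (intro set_integral_norm_bound set_integrable_cell continuous_intros K_cont)
    finally show ?thesis by (simp add: norm_mult)
  qed
  have i: "integrable lborel (\<lambda>v. h v * echar m v)" for m
    by (rule Bochner_Integration.integrable_bound[OF h]) (auto simp: norm_mult)
  have I0: "0 \<le> ?I" by (auto simp: set_lebesgue_integral_def intro!: integral_nonneg_AE)
  have "(LINT v|lborel. h v * K v) = (LINT v|lborel. (\<Sum>m\<in>S. b m * (h v * echar m v)))"
    by (simp add: b sum_distrib_left mult_ac)
  also have "\<dots> = (\<Sum>m\<in>S. b m * ?H m)"
    by (subst Bochner_Integration.integral_sum) (auto intro!: integrable_mult_right i)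
  finally have "norm (LINT v|lborel. h v * K v) \<le> (\<Sum>m\<in>S. norm (b m) * norm (?H m))"
    by (simp add: sum_norm_le norm_mult)
  also have "\<dots> \<le> (\<Sum>m\<in>S. ?I * norm (?H m))"
    by (intro sum_mono mult_right_mono coeff) auto
  finally have "ennreal (norm (LINT v|lborel. h v * K v)) \<le> ennreal (\<Sum>m\<in>S. ?I * norm (?H m))"
    by (rule ennreal_leI)
  also have "\<dots> = ennreal ?I * (\<Sum>m\<in>S. ennreal (norm (?H m)))"
    using I0 by (simp add: sum_distrib_left[symmetric] ennreal_mult sum_nonneg)
  also have "(\<Sum>m\<in>S. ennreal (norm (?H m))) = (\<integral>\<^sup>+m. ennreal (norm (?H m)) * indicator S m \<partial>count_space UNIV)"
    using S by (simp add: nn_integral_count_space_finite nn_integral_count_space_indicator[symmetric])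
  \<comment> \<open>The unknown frequency set \<open>S\<close> is enlarged to all frequencies, which
    makes the bound depend on \<open>K\<close> only through its integral.\<close>
  also have "\<dots> \<le> (\<integral>\<^sup>+m. ennreal (norm (?H m)) \<partial>count_space UNIV)"
    by (intro nn_integral_mono) (auto split: split_indicator)
  finally show ?thesis by (simp add: mult_left_mono)
qed

section \<open>A kernel concentrating on the lattice\<close>

text \<open>Each factor is the square of \<open>cos (pi * v $ j)\<close>. The product takes values
  in [0, 1] and equals one exactly on the integer lattice, so its normalised powers concentrate
  there.\<close>

definition peak :: "real ^ 'd \<Rightarrow> real" where
  "peak v = (\<Prod>j\<in>UNIV. (1 + cos (2 * pi * v $ j)) / 2)"

lemma trig_poly_peak: "trig_poly (\<lambda>v :: real ^ 'd. complex_of_real (peak v))"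
proof -
  have "complex_of_real ((1 + cos (2 * pi * v $ j)) / 2) =
      1 / 2 + 1 / 4 * (echar (axis j 1) v + echar (axis j (- 1)) v)" for v :: "real ^ 'd" and j
  proof -
    have "ivec (axis j 1) = axis j 1" "ivec (axis j (- 1)) = axis j (- 1)"
      by (auto simp: vec_eq_iff axis_def)
    then show ?thesis by (simp add: echar_def inner_axis' complex_eq_iff field_simps)
  qed
  then have "complex_of_real (peak v) =
      (\<Prod>j\<in>UNIV. 1 / 2 + 1 / 4 * (echar (axis j 1) v + echar (axis j (- 1)) v))" for v :: "real ^ 'd"
    unfolding peak_def of_real_prod by (intro prod.cong refl)
  moreover have "trig_poly (\<lambda>v :: real ^ 'd. \<Prod>j\<in>UNIV. 1 / 2 + 1 / 4 * (echar (axis j 1) v + echar (axis j (- 1)) v))"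
    by (intro trig_poly_prod trig_poly_add trig_poly_cmult trig_poly_const trig_poly_echar) auto
  ultimately show ?thesis by (simp only:)
qed

lemma one_plus_cos_nonneg: "0 \<le> 1 + cos (x :: real)"
  using abs_cos_le_one[of x] unfolding abs_le_iff by linarith

lemma peak_nonneg: "0 \<le> peak v"
  by (auto simp: peak_def one_plus_cos_nonneg intro!: prod_nonneg)

lemma peak_le_1: "peak v \<le> 1"
  by (auto simp: peak_def one_plus_cos_nonneg intro!: prod_le_1)

lemma peak_0 [simp]: "peak 0 = 1"
  by (simp add: peak_def)

lemma continuous_peak [continuous_intros]:
  fixes f :: "'a :: t2_space \<Rightarrow> real ^ 'd"
  shows "continuous_on S f \<Longrightarrow> continuous_on S (\<lambda>x. peak (f x))"
  unfolding peak_def by (intro continuous_intros) auto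

text \<open>In this cube \<open>2 * pi * v $ j\<close> has absolute value at most \<open>pi\<close>,
  where cosine is strictly decreasing in the absolute value. One nonzero coordinate therefore makes
  its factor less than one, and the others are at most one.\<close>

lemma peak_less_1:
  assumes v: "v \<in> cbox (\<chi> j. - 1 / 2) (\<chi> j. 1 / 2)" and "v \<noteq> 0"
  shows "peak v < 1"
proof -
  obtain j where j: "v $ j \<noteq> 0" using \<open>v \<noteq> 0\<close> by (auto simp: vec_eq_iff)
  have "\<bar>v $ j\<bar> \<le> 1 / 2" using v[unfolded mem_box_cart, THEN spec, of j] by (auto simp: abs_le_iff)
  then have "cos \<bar>2 * pi * v $ j\<bar> < cos 0"
    using j by (intro cos_monotone_0_pi) (auto simp: abs_mult)
  then have l: "(1 + cos (2 * pi * v $ j)) / 2 < 1" unfolding cos_abs_real by simp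
  have "peak v = (1 + cos (2 * pi * v $ j)) / 2 * (\<Prod>i\<in>UNIV - {j}. (1 + cos (2 * pi * v $ i)) / 2)"
    unfolding peak_def by (subst prod.remove[of _ j]) auto
  also have "\<dots> \<le> (1 + cos (2 * pi * v $ j)) / 2 * 1"
    by (intro mult_left_mono prod_le_1) (auto simp: one_plus_cos_nonneg)
  finally show ?thesis using l by simp
qed

text \<open>The closed cube minus an open ball is compact, so \<open>peak\<close> attains its
  maximum there, and that maximum is below one.\<close>

lemma peak_separated:
  assumes "0 < \<delta>"
  obtains q where "0 \<le> q" "q < 1" "\<And>v :: real ^ 'd. v \<in> cell (- 1 / 2) 1 \<Longrightarrow> \<delta> \<le> norm v \<Longrightarrow> peak v \<le> q"
proof -
  let ?B = "cbox (\<chi> j. - 1 / 2) (\<chi> j. 1 / 2) :: (real ^ 'd) set"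
  let ?C = "?B - ball 0 \<delta>"
  have sub: "v \<in> ?C" if "v \<in> cell (- 1 / 2) 1" "\<delta> \<le> norm v" for v :: "real ^ 'd"
    using that by (auto simp: cell_def mem_box_cart less_imp_le)
  show thesis
  proof (cases "?C = {}")
    case True
    have False if "v \<in> cell (- 1 / 2) 1" "\<delta> \<le> norm v" for v :: "real ^ 'd"
      using sub[OF that] unfolding True by (rule emptyE)
    then show thesis by (intro that[of 0]) auto
  next
    case False
    have "compact ?C" by (intro compact_diff) auto
    then obtain w where w: "w \<in> ?C" "\<forall>v\<in>?C. peak v \<le> peak w"
      using continuous_attains_sup[OF _ False continuous_peak[OF continuous_on_id]] by blast
    moreover have "w \<noteq> 0" using w \<open>0 < \<delta>\<close> by auto
    ultimately show thesis
      using sub peak_less_1[of w] peak_nonneg[of w] by (intro that[of "peak w"]) blast+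
  qed
qed

text \<open>The value depends on the dimension alone, so the \<open>itself\<close> argument carries
  the index type.\<close>

definition peak_mass :: "('d :: finite) itself \<Rightarrow> nat \<Rightarrow> real" where
  "peak_mass T n = (LINT v:cell (- 1 / 2) 1|lborel. peak (v :: real ^ 'd) ^ n)"

text \<open>By continuity \<open>peak\<close> exceeds \<open>q\<close> on a ball around the origin,
  and the volume of a ball serves as \<open>c\<close>. The mass thus decays no faster than any
  geometric rate below one, so that dividing by it preserves smallness away from the
  lattice.\<close>

lemma peak_mass_ge:
  assumes "0 < q" "q < 1"
  obtains c where "0 < c" "\<And>n. c * q ^ n \<le> peak_mass TYPE('d :: finite) n"
proof -
  have "open {v :: real ^ 'd. q < peak v}"
    by (intro open_Collect_less continuous_intros)
  moreover have "0 \<in> {v :: real ^ 'd. q < peak v}" using assms by simp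
  ultimately obtain r where r: "0 < r" "ball 0 r \<subseteq> {v :: real ^ 'd. q < peak v}"
    by (meson openE)
  \<comment> \<open>The cap \<open>1 / 2\<close> keeps the ball inside the cell.\<close>
  define s where "s = min r (1 / 2)"
  let ?U = "ball 0 s :: (real ^ 'd) set"
  have U: "q \<le> peak v" "v \<in> cell (- 1 / 2) 1" if "v \<in> ?U" for v
  proof -
    have n: "norm v < r" "norm v < 1 / 2" using that by (auto simp: s_def)
    then have "v \<in> ball 0 r" by simp
    then have "v \<in> {v. q < peak v}" using r(2) by blast
    then show "q \<le> peak v" by simp
    have "- 1 / 2 \<le> v $ j \<and> v $ j < 1 / 2" for j
      using component_le_norm_cart[of v j] n by linarith
    then show "v \<in> cell (- 1 / 2) 1" by (simp add: cell_def)
  qed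
  have fin: "emeasure lborel ?U < \<infinity>" using emeasure_lborel_ball_finite[of 0 s] by (simp add: top.not_eq_extremum)
  have "measure lborel ?U * q ^ n \<le> peak_mass TYPE('d) n" for n
  proof -
    have "measure lborel ?U * q ^ n = (LINT v|lborel. indicator ?U v *\<^sub>R q ^ n)"
      using fin by (simp add: top.not_eq_extremum)
    also have "\<dots> \<le> (LINT v|lborel. indicator (cell (- 1 / 2) 1) v *\<^sub>R peak (v :: real ^ 'd) ^ n)"
    proof (rule Bochner_Integration.integral_mono)
      show "integrable lborel (\<lambda>v. indicator ?U v *\<^sub>R q ^ n)"
        using fin by (simp add: integrable_indicator_iff)
      show "integrable lborel (\<lambda>v. indicator (cell (- 1 / 2) 1) v *\<^sub>R peak (v :: real ^ 'd) ^ n)"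
        using set_integrable_cell[of "\<lambda>v. peak v ^ n" "- 1 / 2" 1]
        unfolding set_integrable_def by (simp add: continuous_intros)
      show "indicator ?U v *\<^sub>R q ^ n \<le> indicator (cell (- 1 / 2) 1) v *\<^sub>R peak v ^ n" for v :: "real ^ 'd"
        using U[of v] assms by (auto split: split_indicator intro!: power_mono zero_le_power peak_nonneg)
    qed
    finally show ?thesis by (simp add: peak_mass_def set_lebesgue_integral_def)
  qed
  moreover have "0 < measure lborel ?U"
    using content_ball_pos[of s "0 :: real ^ 'd"] r by (simp add: s_def)
  ultimately show thesis by (rule that[rotated])
qed

lemma peak_mass_pos: "0 < peak_mass TYPE('d :: finite) n"
proof -
  obtain c where "0 < c" "\<And>n. c * (1 / 2) ^ n \<le> peak_mass TYPE('d) n"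
    using peak_mass_ge[of "1 / 2"] by auto
  then show ?thesis by (meson less_le_trans mult_pos_pos zero_less_power half_gt_zero zero_less_one)
qed

text \<open>Near the origin \<open>g\<close> is close to \<open>g 0\<close>; elsewhere in the cell
  \<open>peak\<close> is at most some \<open>q\<close> below one, and this part is negligible even
  after division by the mass.\<close>

lemma peak_approx_identity:
  fixes g :: "real ^ 'd \<Rightarrow> complex"
  assumes g: "continuous_on UNIV g" and M: "\<And>v. norm (g v) \<le> M"
  shows "(\<lambda>n. (LINT v:cell (- 1 / 2) 1|lborel. g v * of_real (peak v ^ n)) / of_real (peak_mass TYPE('d) n))
    \<longlonglongrightarrow> g 0"
proof (rule LIMSEQ_I)
  fix e :: real assume "0 < e"
  define Q where "Q = (cell (- 1 / 2) 1 :: (real ^ 'd) set)"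
  define D where "D = peak_mass TYPE('d)"
  have D_pos: "0 < D n" for n by (simp add: D_def peak_mass_pos)
  have M0: "0 \<le> M" using M[of 0] norm_ge_zero order_trans by blast
  obtain \<delta> where \<delta>: "0 < \<delta>" "\<And>v. norm v < \<delta> \<Longrightarrow> norm (g v - g 0) < e / 2"
    using g \<open>0 < e\<close> unfolding continuous_on_iff
    by (metis UNIV_I dist_norm diff_zero half_gt_zero)
  obtain q where q: "0 \<le> q" "q < 1" "\<And>v. v \<in> Q \<Longrightarrow> \<delta> \<le> norm v \<Longrightarrow> peak v \<le> q"
    using peak_separated[OF \<delta>(1)] unfolding Q_def by metis
  \<comment> \<open>A rate strictly between \<open>q\<close> and one, positive even if
    \<open>q\<close> is zero: the far part has order \<open>q ^ n\<close>, the mass at least order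
    \<open>q' ^ n\<close>, and the quotient tends to zero.\<close>
  define q' where "q' = (q + 1) / 2"
  have q': "0 < q'" "q' < 1" "q < q'" using q by (auto simp: q'_def)
  obtain c where c: "0 < c" "\<And>n. c * q' ^ n \<le> D n"
    using peak_mass_ge[OF q'(1,2)] unfolding D_def by metis
  have ci: "set_integrable lborel Q f" if "continuous_on UNIV f" for f :: "real ^ 'd \<Rightarrow> 'e :: {banach, second_countable_topology}"
    unfolding Q_def by (rule set_integrable_cell[OF that])
  have bound: "norm ((LINT v:Q|lborel. g v * of_real (peak v ^ n)) / of_real (D n) - g 0)
      \<le> e / 2 + 2 * M / c * (q / q') ^ n" for n
  proof -
    have "(LINT v:Q|lborel. g v * of_real (peak v ^ n)) - g 0 * of_real (D n) =
        (LINT v:Q|lborel. (g v - g 0) * of_real (peak v ^ n))"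
    proof -
      have "complex_of_real (D n) = (LINT v:Q|lborel. of_real (peak v ^ n))"
        unfolding D_def Q_def peak_mass_def by (rule set_integral_complex_of_real[symmetric])
      then have "g 0 * of_real (D n) = (LINT v:Q|lborel. g 0 * of_real (peak v ^ n))"
        by simp
      then show ?thesis unfolding left_diff_distrib
        by (subst set_integral_diff) (auto intro!: ci continuous_intros g)
    qed
    also have "norm \<dots> \<le> (LINT v:Q|lborel. norm ((g v - g 0) * of_real (peak v ^ n)))"
      by (intro set_integral_norm_bound ci continuous_intros g)
    \<comment> \<open>The first summand dominates on the ball of radius \<open>\<delta>\<close>, the
      second outside it; adding both avoids splitting the domain of integration.\<close>
    also have "\<dots> \<le> (LINT v:Q|lborel. e / 2 * peak v ^ n + 2 * M * q ^ n)"
    proof (rule set_integral_mono)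
      show "norm ((g v - g 0) * of_real (peak v ^ n)) \<le> e / 2 * peak v ^ n + 2 * M * q ^ n"
        if "v \<in> Q" for v
      proof (cases "norm v < \<delta>")
        case True
        then have "norm (g v - g 0) * peak v ^ n \<le> e / 2 * peak v ^ n"
          using \<delta>(2)[of v] by (intro mult_right_mono) (auto simp: peak_nonneg)
        then show ?thesis using M0 q
          by (simp add: norm_mult norm_power peak_nonneg add_increasing2)
      next
        case False
        have "norm (g v - g 0) \<le> 2 * M"
          using norm_triangle_ineq4[of "g v" "g 0"] M[of v] M[of 0] by linarith
        then have "norm (g v - g 0) * peak v ^ n \<le> 2 * M * q ^ n"
          using False that q M0 by (intro mult_mono power_mono) (auto simp: peak_nonneg)
        then show ?thesis using \<open>0 < e\<close>
          by (simp add: norm_mult norm_power peak_nonneg add_increasing)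
      qed
    qed (auto intro!: ci continuous_intros g)
    also have "\<dots> = e / 2 * D n + 2 * M * q ^ n"
    proof -
      have "(LINT v:Q|lborel. 2 * M * q ^ n) = 2 * M * q ^ n"
        using measure_cell[of 1 "- 1 / 2", where 'd = 'd]
        by (simp add: set_lebesgue_integral_def Q_def)
      moreover have "(LINT v:Q|lborel. e / 2 * peak v ^ n + 2 * M * q ^ n) =
          (LINT v:Q|lborel. e / 2 * peak v ^ n) + (LINT v:Q|lborel. 2 * M * q ^ n)"
        by (intro set_integral_add ci continuous_intros)
      ultimately show ?thesis by (simp add: D_def peak_mass_def Q_def)
    qed
    finally have *: "norm ((LINT v:Q|lborel. g v * of_real (peak v ^ n)) - g 0 * of_real (D n))
        \<le> e / 2 * D n + 2 * M * q ^ n" .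
    have "norm ((LINT v:Q|lborel. g v * of_real (peak v ^ n)) / of_real (D n) - g 0) =
        norm (((LINT v:Q|lborel. g v * of_real (peak v ^ n)) - g 0 * of_real (D n)) / of_real (D n))"
      using D_pos[of n] by (simp add: field_simps)
    also have "\<dots> \<le> (e / 2 * D n + 2 * M * q ^ n) / D n"
      using * D_pos[of n] by (simp add: norm_divide divide_right_mono)
    also have "\<dots> = e / 2 + 2 * M * q ^ n / D n" using D_pos[of n] by (simp add: field_simps)
    also have "\<dots> \<le> e / 2 + 2 * M * q ^ n / (c * q' ^ n)"
      using c q' M0 q D_pos[of n] by (intro add_left_mono divide_left_mono) auto
    finally show ?thesis by (simp add: power_divide)
  qed
  have "(\<lambda>n. 2 * M / c * (q / q') ^ n) \<longlonglongrightarrow> 2 * M / c * 0"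
    using q q' by (intro tendsto_intros LIMSEQ_power_zero) auto
  then have "\<forall>\<^sub>F n in sequentially. 2 * M / c * (q / q') ^ n < e / 2"
    using \<open>0 < e\<close> by (intro order_tendstoD) auto
  then obtain N where N: "\<And>n. N \<le> n \<Longrightarrow> 2 * M / c * (q / q') ^ n < e / 2"
    by (auto simp: eventually_sequentially)
  have "norm ((LINT v:Q|lborel. g v * of_real (peak v ^ n)) / of_real (D n) - g 0) < e" if "N \<le> n" for n
    using bound[of n] N[OF that] by linarith
  then show "\<exists>N. \<forall>n\<ge>N. norm ((LINT v:cell (- 1 / 2) 1|lborel. g v * of_real (peak v ^ n)) / of_real (peak_mass TYPE('d) n) - g 0) < e"
    unfolding Q_def D_def by blast
qed

section \<open>The Poisson inequality\<close>

lemma bounded_compact_supp: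
  fixes f :: "'a :: euclidean_space \<Rightarrow> 'b :: real_normed_vector"
  assumes f: "continuous_on UNIV f" and s: "\<And>x. f x \<noteq> 0 \<Longrightarrow> x \<in> cbox l u"
  obtains M where "\<And>x. norm (f x) \<le> M"
proof -
  have "compact (f ` cbox l u)"
    by (intro compact_continuous_image continuous_on_subset[OF f]) auto
  then obtain M where "\<forall>x\<in>cbox l u. norm (f x) \<le> M"
    by (auto dest!: compact_imp_bounded simp: bounded_iff)
  then have "norm (f x) \<le> max M 0" for x using s[of x] by (cases "f x = 0") force+
  then show thesis by (rule that)
qed

text \<open>Integrate \<open>h\<close> against the normalised powers of \<open>peak\<close>. Folded
  onto one cell, these integrals converge to the lattice sum, while the trigonometric polynomial
  bound holds for each of them with constant one. The set \<open>S\<close> may be any finite set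
  containing the lattice support of \<open>h\<close>.\<close>

lemma poisson_inequality:
  fixes h :: "real ^ 'd \<Rightarrow> complex"
  assumes h: "continuous_on UNIV h" and R: "\<And>v j. h v \<noteq> 0 \<Longrightarrow> \<bar>v $ j\<bar> \<le> R"
    and S: "finite S" "\<And>k. k \<notin> S \<Longrightarrow> h (ivec k) = 0"
  shows "ennreal (norm (\<Sum>k\<in>S. h (ivec k))) \<le>
    (\<integral>\<^sup>+m. ennreal (norm (LINT v|lborel. h v * echar m v)) \<partial>count_space UNIV)"
proof -
  define Q where "Q = (cell (- 1 / 2) 1 :: (real ^ 'd) set)"
  define D where "D = peak_mass TYPE('d)"
  \<comment> \<open>A cell centred at a lattice point reaches \<open>1 / 2\<close> in each
    coordinate, so the margin \<open>1\<close> captures every cell that meets the support of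
    \<open>h\<close>.\<close>
  define S' where "S' = {k :: int ^ 'd. \<forall>j. \<bar>real_of_int (k $ j)\<bar> \<le> R + 1}"
  let ?K = "\<lambda>n v :: real ^ 'd. complex_of_real (peak v ^ n)"
  let ?H = "\<integral>\<^sup>+m. ennreal (norm (LINT v|lborel. h v * echar m v)) \<partial>count_space UNIV"
  have D_pos: "0 < D n" for n by (simp add: D_def peak_mass_pos)
  have Q_sets [measurable]: "Q \<in> sets borel" by (simp add: Q_def)
  have [measurable]: "h \<in> borel_measurable borel" "peak \<in> borel_measurable (borel :: (real ^ 'd) measure)"
    by (intro borel_measurable_continuous_onI h continuous_intros)+
  have S': "finite S'" unfolding S'_def by (rule finite_bounded_ivec)
  have hbox: "v \<in> cbox (\<chi> j. - R) (\<chi> j. R)" if "h v \<noteq> 0" for v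
    using R[OF that] by (auto simp: mem_box_cart abs_le_iff minus_le_iff)
  obtain M where M: "\<And>v. norm (h v) \<le> M" by (rule bounded_compact_supp[OF h hbox]) auto
  have hi: "integrable lborel h" by (rule integrable_compact_supp[OF h hbox])
  have per: "peak (v + ivec k) = peak v" for v :: "real ^ 'd" and k
  proof -
    have "cos (2 * pi * (x + of_int n)) = cos (2 * pi * x)" for x and n :: int
      by (simp only: distrib_left cos_add cos_int_2pin sin_int_2pin mult_1_right mult_zero_right diff_zero)
    then show ?thesis by (simp add: peak_def)
  qed
  have unfold: "(LINT v|lborel. h v * ?K n v) = (\<Sum>k\<in>S'. LINT v:Q|lborel. h (v + ivec k) * ?K n v)" for n
  proof -
    have i: "integrable lborel (\<lambda>v. h v * ?K n v * indicator Q (v - ivec k))" for k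
      by (rule Bochner_Integration.integrable_bound[OF hi])
        (auto simp: norm_mult norm_power peak_nonneg power_le_one peak_le_1
          intro!: mult_left_le split: split_indicator)
    have "h v * ?K n v = (\<Sum>k\<in>S'. h v * ?K n v * indicator Q (v - ivec k))" for v
    proof (cases "h v = 0")
      case False
      define u where "u = (\<chi> j. \<lfloor>(v $ j - - 1 / 2) / 1\<rfloor>)"
      have q: "indicator Q (v - ivec k) = (if k = u then 1 else 0 :: complex)" for k
        using mem_cell_floor[of 1 v k "- 1 / 2"] by (auto simp: Q_def u_def)
      have "\<bar>real_of_int (u $ j)\<bar> \<le> R + 1" for j
        using R[OF False, of j] unfolding u_def by (simp; linarith)
      then have "u \<in> S'" by (simp add: S'_def)
      then show ?thesis using S' by (simp add: q if_distrib cong: if_cong)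
    qed simp
    then have "(LINT v|lborel. h v * ?K n v) = (LINT v|lborel. (\<Sum>k\<in>S'. h v * ?K n v * indicator Q (v - ivec k)))"
      by simp
    also have "\<dots> = (\<Sum>k\<in>S'. LINT v|lborel. h v * ?K n v * indicator Q (v - ivec k))"
      by (intro Bochner_Integration.integral_sum i)
    also have "\<dots> = (\<Sum>k\<in>S'. LINT v|lborel. h (v + ivec k) * ?K n v * indicator Q v)"
      using integral_translate[of "\<lambda>v. h v * ?K n v * indicator Q (v - ivec k)" "ivec k" for k]
      by (simp add: per)
    finally show ?thesis
      by (simp add: set_lebesgue_integral_def scaleR_conv_of_real of_real_indicator mult_ac)
  qed
  have "(\<lambda>n. (\<Sum>k\<in>S'. (LINT v:Q|lborel. h (v + ivec k) * ?K n v) / of_real (D n)))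
      \<longlonglongrightarrow> (\<Sum>k\<in>S'. h (0 + ivec k))"
    unfolding Q_def D_def
    by (intro tendsto_sum peak_approx_identity[where M = M] M continuous_on_compose2[OF h] continuous_intros) auto
  then have lim: "(\<lambda>n. (LINT v|lborel. h v * ?K n v) / of_real (D n)) \<longlonglongrightarrow> (\<Sum>k\<in>S'. h (ivec k))"
    by (simp only: unfold sum_divide_distrib add_0_left)
  have bound: "ennreal (norm ((LINT v|lborel. h v * ?K n v) / of_real (D n))) \<le> ?H" for n
  proof -
    have "trig_poly (?K n)" using trig_poly_power[OF trig_poly_peak, of n] by simp
    from norm_integral_mult_trig_poly_le[OF hi this, of "- 1 / 2"]
    have "ennreal (norm (LINT v|lborel. h v * ?K n v)) \<le> ennreal (D n) * ?H"
      by (simp add: norm_power peak_nonneg D_def peak_mass_def)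
    then have "ennreal (1 / D n) * ennreal (norm (LINT v|lborel. h v * ?K n v))
        \<le> ennreal (1 / D n) * (ennreal (D n) * ?H)"
      by (rule mult_left_mono) simp
    also have "\<dots> = ?H"
      using D_pos[of n] by (simp add: mult.assoc[symmetric] ennreal_mult[symmetric] less_imp_le)
    finally show ?thesis
      using D_pos[of n] by (simp add: norm_divide ennreal_mult[symmetric] less_imp_le)
  qed
  have "ennreal (norm (\<Sum>k\<in>S'. h (ivec k))) \<le> ?H"
    by (rule LIMSEQ_le_const2[OF tendsto_ennrealI[OF tendsto_norm[OF lim]]]) (intro exI allI impI bound)
  \<comment> \<open>Both index sets contain all lattice points where \<open>h\<close> is
    nonzero.\<close>
  moreover have "(\<Sum>k\<in>S'. h (ivec k)) = (\<Sum>k\<in>S. h (ivec k))"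
  proof (rule sum.mono_neutral_cong)
    show "h (ivec k) = 0" if "k \<in> S - S'" for k
    proof (rule ccontr)
      assume "h (ivec k) \<noteq> 0"
      then have "\<bar>real_of_int (k $ j)\<bar> \<le> R + 1" for j using R[of "ivec k" j] by simp
      then have "k \<in> S'" by (simp add: S'_def)
      then show False using that by simp
    qed
  qed (use S S' in auto)
  ultimately show ?thesis by simp
qed

section \<open>The upper bound\<close>

text \<open>Subadditivity of the \<open>p\<close>-th power for infinite sums. If \<open>R\<close> is
  the sum of the \<open>p\<close>-th powers, each of them is at most \<open>R\<close>, so
  \<open>a i\<close> is at most \<open>a i powr p\<close> times \<open>R powr ((1 - p) / p)\<close>.
  Summation bounds \<open>z\<close> by \<open>R powr (1 / p)\<close>.\<close>

lemma ennreal_powr_le_nn_integral_powr: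
  fixes a :: "'i \<Rightarrow> real"
  assumes p: "0 < p" "p \<le> 1" and a: "\<And>i. 0 \<le> a i" and z: "0 \<le> z"
    and le: "ennreal z \<le> (\<integral>\<^sup>+i. ennreal (a i) \<partial>count_space UNIV)"
  shows "ennreal (z powr p) \<le> (\<integral>\<^sup>+i. ennreal (a i powr p) \<partial>count_space UNIV)" (is "_ \<le> ?J")
proof (cases "?J = top")
  case False
  then obtain R where R: "0 \<le> R" "?J = ennreal R" by (cases ?J) auto
  have "a i powr p \<le> R" for i
  proof -
    have "ennreal (a i powr p) \<le> ?J" by (rule nn_integral_ge_point) simp
    then show ?thesis using R by simp
  qed
  have pt: "a i \<le> a i powr p * R powr ((1 - p) / p)" for i
  proof (cases "a i = 0")
    case False
    then have "0 < a i" using a[of i] by simp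
    then have "a i = a i powr p * (a i powr p) powr ((1 - p) / p)"
      using p by (simp add: powr_powr powr_add[symmetric])
    also have "\<dots> \<le> a i powr p * R powr ((1 - p) / p)"
      using p \<open>a i powr p \<le> R\<close> by (intro mult_left_mono powr_mono2) auto
    finally show ?thesis .
  qed simp
  have "ennreal z \<le> (\<integral>\<^sup>+i. ennreal (a i powr p) * ennreal (R powr ((1 - p) / p)) \<partial>count_space UNIV)"
    by (rule order_trans[OF le]) (auto intro!: nn_integral_mono ennreal_leI pt simp: ennreal_mult[symmetric])
  also have "\<dots> = ennreal (R * R powr ((1 - p) / p))"
    using R by (simp add: nn_integral_multc ennreal_mult)
  also have "R * R powr ((1 - p) / p) = R powr (1 / p)"
  proof (cases "R = 0")
    case False
    then have "R * R powr ((1 - p) / p) = R powr (1 + (1 - p) / p)" using R by (simp add: powr_add)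
    also have "1 + (1 - p) / p = 1 / p" using p by (simp add: field_simps)
    finally show ?thesis .
  qed simp
  finally have "z \<le> R powr (1 / p)" by simp
  then have "z powr p \<le> (R powr (1 / p)) powr p" using z p by (intro powr_mono2) auto
  then show ?thesis using p R by (simp add: powr_powr)
qed simp

section \<open>The lattice sum as a finite trigonometric sum\<close>

lemma stretch_ivec: "stretch \<epsilon> (ivec k) = (\<chi> j. \<epsilon> $ j * of_int (k $ j))"
  by (simp add: vec_eq_iff)

lemma compact_support_bound:
  fixes \<phi> :: "real ^ 'd \<Rightarrow> complex"
  assumes "compact_support \<phi>"
  obtains R where "\<And>v j. \<phi> v \<noteq> 0 \<Longrightarrow> \<bar>v $ j\<bar> \<le> R"
proof -
  have "bounded (closure {x. \<phi> x \<noteq> 0})"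
    using assms by (simp add: compact_support_def compact_imp_bounded)
  then obtain R where "\<And>v. v \<in> closure {x. \<phi> x \<noteq> 0} \<Longrightarrow> norm v \<le> R"
    by (auto simp: bounded_iff)
  then have "\<phi> v \<noteq> 0 \<Longrightarrow> \<bar>v $ j\<bar> \<le> R" for v j
    using component_le_norm_cart[of v j] closure_subset[of "{x. \<phi> x \<noteq> 0}"]
    by (metis (mono_tags, lifting) mem_Collect_eq order_trans subsetD)
  then show thesis by (rule that)
qed

lemma stretch_support_bound:
  fixes \<phi> :: "real ^ 'd \<Rightarrow> complex"
  assumes \<phi>: "compact_support \<phi>" and \<epsilon>: "\<And>j. \<epsilon> $ j \<noteq> 0"
  obtains R where "\<And>v j. \<phi> (stretch \<epsilon> v) \<noteq> 0 \<Longrightarrow> \<bar>v $ j\<bar> \<le> R"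
proof -
  obtain R where R: "\<And>v j. \<phi> v \<noteq> 0 \<Longrightarrow> \<bar>v $ j\<bar> \<le> R"
    using compact_support_bound[OF \<phi>] by metis
  \<comment> \<open>The sum is a single bound serving all coordinates. The absolute value is taken
    because \<open>R\<close> may be negative if \<phi> vanishes identically.\<close>
  have "\<bar>v $ j\<bar> \<le> (\<Sum>i\<in>UNIV. \<bar>R\<bar> / \<bar>\<epsilon> $ i\<bar>)" if "\<phi> (stretch \<epsilon> v) \<noteq> 0" for v j
  proof -
    have "\<bar>\<epsilon> $ j\<bar> * \<bar>v $ j\<bar> \<le> \<bar>R\<bar>" using R[OF that, of j] by (simp add: abs_mult)
    then have "\<bar>v $ j\<bar> \<le> \<bar>R\<bar> / \<bar>\<epsilon> $ j\<bar>" using \<epsilon>[of j] by (simp add: field_simps)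
    also have "\<dots> \<le> (\<Sum>i\<in>UNIV. \<bar>R\<bar> / \<bar>\<epsilon> $ i\<bar>)" by (intro member_le_sum) auto
    finally show ?thesis .
  qed
  then show thesis by (rule that)
qed

lemma finite_lattice_support:
  fixes \<phi> :: "real ^ 'd \<Rightarrow> complex"
  assumes "compact_support \<phi>" and "\<And>j. \<epsilon> $ j \<noteq> 0"
  shows "finite {k. \<phi> (stretch \<epsilon> (ivec k)) \<noteq> 0}"
proof -
  obtain R where "\<And>v j. \<phi> (stretch \<epsilon> v) \<noteq> 0 \<Longrightarrow> \<bar>v $ j\<bar> \<le> R"
    using stretch_support_bound[OF assms] by metis
  then have "{k. \<phi> (stretch \<epsilon> (ivec k)) \<noteq> 0} \<subseteq> {k. \<forall>j. \<bar>real_of_int (k $ j)\<bar> \<le> R}"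
    by (auto simp flip: ivec_nth)
  then show ?thesis by (rule finite_subset) (rule finite_bounded_ivec)
qed

lemma Phi_eq_sum:
  fixes \<phi> :: "real ^ 'd \<Rightarrow> complex"
  assumes "compact_support \<phi>" and "\<And>j. \<epsilon> $ j \<noteq> 0"
  shows "Phi \<phi> \<epsilon> x =
    (\<Sum>k | \<phi> (stretch \<epsilon> (ivec k)) \<noteq> 0. \<phi> (stretch \<epsilon> (ivec k)) * cis (ivec k \<bullet> x))"
proof -
  have "Phi \<phi> \<epsilon> x = (\<Sum>\<^sub>\<infinity>k. \<phi> (stretch \<epsilon> (ivec k)) * cis (ivec k \<bullet> x))"
    by (simp add: Phi_def stretch_ivec[symmetric] ivec_def[symmetric] cis_conv_exp)
  also have "\<dots> = (\<Sum>\<^sub>\<infinity>k\<in>{k. \<phi> (stretch \<epsilon> (ivec k)) \<noteq> 0}. \<phi> (stretch \<epsilon> (ivec k)) * cis (ivec k \<bullet> x))"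
    by (rule infsum_cong_neutral) auto
  finally show ?thesis by (simp add: finite_lattice_support assms)
qed

lemma continuous_Phi:
  fixes \<phi> :: "real ^ 'd \<Rightarrow> complex"
  assumes "compact_support \<phi>" and "\<And>j. \<epsilon> $ j \<noteq> 0"
  shows "continuous_on UNIV (Phi \<phi> \<epsilon>)"
proof -
  have "continuous_on UNIV (\<lambda>x. \<Sum>k | \<phi> (stretch \<epsilon> (ivec k)) \<noteq> 0. \<phi> (stretch \<epsilon> (ivec k)) * cis (ivec k \<bullet> x))"
    by (intro continuous_intros)
  then show ?thesis using Phi_eq_sum[OF assms] by (simp add: fun_eq_iff[symmetric])
qed

text \<open>The substitution \<open>y = stretch \<epsilon> v\<close> divides the frequency
  \<open>w\<close> by the entries of \<open>\<epsilon>\<close> and the integral by their absolute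
  product; the minus sign comes from the sign convention of the transform.\<close>

lemma fourier_transform_stretch:
  fixes \<phi> :: "real ^ 'd \<Rightarrow> complex"
  assumes [measurable]: "\<phi> \<in> borel_measurable borel" and \<epsilon>: "\<And>j. \<epsilon> $ j \<noteq> 0"
  shows "(LINT v|lborel. \<phi> (stretch \<epsilon> v) * cis (v \<bullet> w)) =
    of_real ((2 * pi) powr (real CARD('d) / 2) / (\<Prod>j\<in>UNIV. \<bar>\<epsilon> $ j\<bar>)) *
      fourier_transform \<phi> (stretch (\<chi> j. - 1 / \<epsilon> $ j) w)"
proof -
  let ?P = "\<Prod>j\<in>UNIV. \<bar>\<epsilon> $ j\<bar>" and ?C = "(2 * pi) powr (real CARD('d) / 2)"
  let ?w = "stretch (\<chi> j. - 1 / \<epsilon> $ j) w"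
  have P: "?P \<noteq> 0" using \<epsilon> by simp
  have "stretch \<epsilon> v \<bullet> ?w = - (v \<bullet> w)" for v
    using \<epsilon> by (simp add: inner_vec_def sum_negf[symmetric])
  then have "(LINT y|lborel. \<phi> y * exp (- \<i> * complex_of_real (y \<bullet> ?w))) =
      of_real ?P * (LINT v|lborel. \<phi> (stretch \<epsilon> v) * cis (v \<bullet> w))"
    by (subst integral_stretch[OF \<epsilon>]) (auto simp: cis_conv_exp)
  then have "fourier_transform \<phi> ?w =
      of_real (1 / ?C) * (of_real ?P * (LINT v|lborel. \<phi> (stretch \<epsilon> v) * cis (v \<bullet> w)))"
    by (simp add: fourier_transform_def)
  moreover have "?C \<noteq> 0" by simp
  ultimately show ?thesis using P by (simp add: field_simps del: of_real_prod)
qed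

text \<open>The lattice values of \<open>?h\<close> are the terms of \<open>Phi\<close>, and
  multiplication of \<open>?h\<close> by \<open>echar m\<close> replaces \<open>x\<close> by its
  translate by \<open>2 * pi\<close> times \<open>m\<close>. The Poisson inequality therefore
  produces transforms at all translates of \<open>x\<close>.\<close>

lemma norm_Phi_le:
  fixes \<phi> :: "real ^ 'd \<Rightarrow> complex"
  assumes \<phi>: "continuous_on UNIV \<phi>" "compact_support \<phi>" and \<epsilon>: "\<And>j. \<epsilon> $ j \<noteq> 0"
  shows "ennreal (norm (Phi \<phi> \<epsilon> x)) \<le>
    (\<integral>\<^sup>+m. ennreal ((2 * pi) powr (real CARD('d) / 2) / (\<Prod>j\<in>UNIV. \<bar>\<epsilon> $ j\<bar>) *
      norm (fourier_transform \<phi> (stretch (\<chi> j. - 1 / \<epsilon> $ j) (x + (2 * pi) *\<^sub>R ivec m)))) \<partial>count_space UNIV)"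
proof -
  let ?h = "\<lambda>v. \<phi> (stretch \<epsilon> v) * cis (v \<bullet> x)"
  let ?S = "{k. \<phi> (stretch \<epsilon> (ivec k)) \<noteq> 0}"
  have [measurable]: "\<phi> \<in> borel_measurable borel"
    by (intro borel_measurable_continuous_onI \<phi>)
  obtain R where R: "\<And>v j. \<phi> (stretch \<epsilon> v) \<noteq> 0 \<Longrightarrow> \<bar>v $ j\<bar> \<le> R"
    using stretch_support_bound[OF \<phi>(2) \<epsilon>] by metis
  have "norm (LINT v|lborel. ?h v * echar m v) =
      (2 * pi) powr (real CARD('d) / 2) / (\<Prod>j\<in>UNIV. \<bar>\<epsilon> $ j\<bar>) *
      norm (fourier_transform \<phi> (stretch (\<chi> j. - 1 / \<epsilon> $ j) (x + (2 * pi) *\<^sub>R ivec m)))" for m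
  proof -
    have h: "?h v * echar m v = \<phi> (stretch \<epsilon> v) * cis (v \<bullet> (x + (2 * pi) *\<^sub>R ivec m))" for v
      by (simp add: echar_def cis_mult inner_add_right inner_commute)
    have eq: "(LINT v|lborel. ?h v * echar m v) =
        of_real ((2 * pi) powr (real CARD('d) / 2) / (\<Prod>j\<in>UNIV. \<bar>\<epsilon> $ j\<bar>)) *
        fourier_transform \<phi> (stretch (\<chi> j. - 1 / \<epsilon> $ j) (x + (2 * pi) *\<^sub>R ivec m))"
      unfolding h by (rule fourier_transform_stretch) (auto simp: \<epsilon>)
    have "0 \<le> (2 * pi) powr (real CARD('d) / 2) / (\<Prod>j\<in>UNIV. \<bar>\<epsilon> $ j\<bar>)"
      by (intro divide_nonneg_nonneg prod_nonneg) auto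
    then show ?thesis by (simp only: eq norm_mult norm_of_real abs_of_nonneg)
  qed
  moreover have "ennreal (norm (\<Sum>k\<in>?S. ?h (ivec k))) \<le>
      (\<integral>\<^sup>+m. ennreal (norm (LINT v|lborel. ?h v * echar m v)) \<partial>count_space UNIV)"
    by (rule poisson_inequality[where R = R])
      (auto intro!: continuous_intros continuous_on_compose2[OF \<phi>(1)] R finite_lattice_support \<phi> \<epsilon>)
  ultimately show ?thesis by (simp add: Phi_eq_sum[OF \<phi>(2) \<epsilon>])
qed

text \<open>Termwise \<open>p\<close>-th powers of the pointwise bound, unfolding of the torus to
  the whole space, then removal of the dilation.\<close>

lemma nn_integral_Phi_le:
  fixes \<phi> :: "real ^ 'd \<Rightarrow> complex"
  assumes p: "0 < p" "p \<le> 1" and \<phi>: "continuous_on UNIV \<phi>" "compact_support \<phi>"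
    and \<epsilon>: "\<And>j. \<epsilon> $ j \<noteq> 0"
    and [measurable]: "fourier_transform \<phi> \<in> borel_measurable borel"
  defines "P \<equiv> \<Prod>j\<in>UNIV. \<bar>\<epsilon> $ j\<bar>"
  shows "(\<integral>\<^sup>+x\<in>torus_cell. ennreal (norm (Phi \<phi> \<epsilon> x) powr p) \<partial>lborel) \<le>
    ennreal (((2 * pi) powr (real CARD('d) / 2)) powr p * P powr (1 - p)) *
      (\<integral>\<^sup>+\<xi>. ennreal (norm (fourier_transform \<phi> \<xi>) powr p) \<partial>lborel)"
proof -
  define C where "C = (2 * pi) powr (real CARD('d) / 2)"
  let ?\<delta> = "\<chi> j. - 1 / \<epsilon> $ j"
  let ?F = "\<lambda>\<xi>. ennreal (norm (fourier_transform \<phi> \<xi>) powr p)"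
  have C: "0 < C" by (simp add: C_def)
  have P: "0 < P" using \<epsilon> by (simp add: P_def prod_pos)
  have "ennreal (norm (Phi \<phi> \<epsilon> x) powr p) \<le>
      (\<integral>\<^sup>+m. ennreal ((C / P) powr p) * ?F (stretch ?\<delta> (x + (2 * pi) *\<^sub>R ivec m)) \<partial>count_space UNIV)" for x
  proof -
    have "ennreal (norm (Phi \<phi> \<epsilon> x) powr p) \<le> (\<integral>\<^sup>+m. ennreal
        ((C / P * norm (fourier_transform \<phi> (stretch ?\<delta> (x + (2 * pi) *\<^sub>R ivec m)))) powr p) \<partial>count_space UNIV)"
      using P norm_Phi_le[OF \<phi> \<epsilon>, of x]
      by (intro ennreal_powr_le_nn_integral_powr p) (auto simp: P_def C_def)
    moreover have "ennreal ((C / P * norm z) powr p) = ennreal ((C / P) powr p) * ennreal (norm z powr p)" for z :: complex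
      using P C by (simp add: powr_mult powr_divide flip: ennreal_mult)
    ultimately show ?thesis by (simp only:)
  qed
  then have "(\<integral>\<^sup>+x\<in>torus_cell. ennreal (norm (Phi \<phi> \<epsilon> x) powr p) \<partial>lborel) \<le>
      (\<integral>\<^sup>+x\<in>cell 0 (2 * pi). (\<integral>\<^sup>+m. ennreal ((C / P) powr p) * ?F (stretch ?\<delta> (x + (2 * pi) *\<^sub>R ivec m)) \<partial>count_space UNIV) \<partial>lborel)"
    unfolding torus_cell_eq by (intro nn_integral_mono mult_right_mono) auto
  also have "\<dots> = (\<integral>\<^sup>+x. ennreal ((C / P) powr p) * ?F (stretch ?\<delta> x) \<partial>lborel)"
    by (rule nn_integral_unfold[symmetric]) auto
  also have "\<dots> = ennreal ((C / P) powr p) * (\<integral>\<^sup>+x. ?F (stretch ?\<delta> x) \<partial>lborel)"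
    by (simp add: nn_integral_cmult)
  \<comment> \<open>The dilation by \<open>?\<delta>\<close> has Jacobian \<open>1 / P\<close>. The
    factor \<open>P\<close> gained here turns the exponent \<open>-p\<close> of \<open>P\<close>
    into \<open>1 - p\<close>.\<close>
  also have "(\<integral>\<^sup>+x. ?F (stretch ?\<delta> x) \<partial>lborel) = ennreal P * (\<integral>\<^sup>+\<xi>. ?F \<xi> \<partial>lborel)"
  proof -
    have "(\<Prod>j\<in>UNIV. \<bar>?\<delta> $ j\<bar>) = 1 / P"
      by (simp add: P_def prod_dividef)
    then have "(\<integral>\<^sup>+\<xi>. ?F \<xi> \<partial>lborel) = ennreal (1 / P) * (\<integral>\<^sup>+x. ?F (stretch ?\<delta> x) \<partial>lborel)"
      using \<epsilon> by (subst nn_integral_stretch[of ?\<delta>]) auto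
    then have "ennreal P * (\<integral>\<^sup>+\<xi>. ?F \<xi> \<partial>lborel) =
        (ennreal P * ennreal (1 / P)) * (\<integral>\<^sup>+x. ?F (stretch ?\<delta> x) \<partial>lborel)"
      by (simp add: mult.assoc)
    then show ?thesis using P by (simp add: ennreal_mult[symmetric] less_imp_le)
  qed
  also have "ennreal ((C / P) powr p) * (ennreal P * (\<integral>\<^sup>+\<xi>. ?F \<xi> \<partial>lborel)) =
      ennreal ((C / P) powr p * P) * (\<integral>\<^sup>+\<xi>. ?F \<xi> \<partial>lborel)"
    using P by (simp add: ennreal_mult mult.assoc)
  also have "(C / P) powr p * P = C powr p * P powr (1 - p)"
    using P C by (simp add: powr_divide powr_diff)
  finally show ?thesis by (simp only: C_def)
qed

section \<open>The lower bound\<close>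

text \<open>A sequence of mesh sizes, as dominated convergence and Fatou's lemma are applied to
  sequences. The bound by one lets a single box dominate all step functions.\<close>

definition mesh :: "nat \<Rightarrow> real" where
  "mesh n = 1 / real (Suc n)"

lemma mesh_pos: "0 < mesh n" and mesh_le_1: "mesh n \<le> 1"
  by (simp_all add: mesh_def)

lemma mesh_tendsto_0: "mesh \<longlonglongrightarrow> 0"
  unfolding mesh_def using LIMSEQ_inverse_real_of_nat by (simp add: inverse_eq_divide)

text \<open>The Riemann sum is the integral of a step function whose value at \<open>v\<close> is
  \<open>g\<close> at the lower corner of the mesh cell containing \<open>v\<close>. Continuity
  gives pointwise convergence, and dominated convergence does the rest.\<close>

lemma riemann_sum_tendsto:
  fixes g :: "real ^ 'd \<Rightarrow> complex"
  assumes g: "continuous_on UNIV g" and R: "\<And>v j. g v \<noteq> 0 \<Longrightarrow> \<bar>v $ j\<bar> \<le> R"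
    and S: "\<And>n. finite (S n)" "\<And>n k. k \<notin> S n \<Longrightarrow> g (mesh n *\<^sub>R ivec k) = 0"
  shows "(\<lambda>n. of_real (mesh n ^ CARD('d)) * (\<Sum>k\<in>S n. g (mesh n *\<^sub>R ivec k))) \<longlonglongrightarrow> (LINT v|lborel. g v)"
proof -
  have [measurable]: "g \<in> borel_measurable borel"
    by (intro borel_measurable_continuous_onI g)
  define step where "step n v = (\<Sum>k\<in>S n. g (mesh n *\<^sub>R ivec k) * indicator (cell 0 (mesh n)) (v - mesh n *\<^sub>R ivec k))"
    for n and v :: "real ^ 'd"
  define fl where "fl n v = mesh n *\<^sub>R ivec (\<chi> j. \<lfloor>(v $ j - 0) / mesh n\<rfloor>)" for n and v :: "real ^ 'd"
  \<comment> \<open>If the corner belongs to an index outside \<open>S n\<close>, both sides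
    vanish.\<close>
  have step_eq: "step n v = g (fl n v)" for n v
  proof -
    let ?u = "(\<chi> j. \<lfloor>(v $ j - 0) / mesh n\<rfloor>)"
    have "indicator (cell 0 (mesh n)) (v - mesh n *\<^sub>R ivec k) = (if k = ?u then 1 else 0 :: complex)" for k
      using mem_cell_floor[OF mesh_pos, of v n k 0] by auto
    then have "step n v = (\<Sum>k\<in>S n. if k = ?u then g (mesh n *\<^sub>R ivec k) else 0)"
      unfolding step_def by (intro sum.cong) auto
    also have "\<dots> = (if ?u \<in> S n then g (mesh n *\<^sub>R ivec ?u) else 0)"
      using S(1) by simp
    finally show ?thesis using S(2)[of ?u n] by (simp add: fl_def)
  qed
  have fl: "\<bar>fl n v $ j - v $ j\<bar> \<le> mesh n" for n v j
  proof -
    have "v - fl n v \<in> cell 0 (mesh n)"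
      unfolding fl_def by (subst mem_cell_floor[OF mesh_pos]) simp
    then show ?thesis by (auto simp: cell_def abs_le_iff less_imp_le)
  qed
  have "(LINT v|lborel. step n v) = of_real (mesh n ^ CARD('d)) * (\<Sum>k\<in>S n. g (mesh n *\<^sub>R ivec k))" for n
  proof -
    let ?i = "indicator (cell 0 (mesh n)) :: real ^ 'd \<Rightarrow> complex"
    have i: "integrable lborel ?i"
      using set_integrable_cell[of "\<lambda>_. 1 :: complex" 0 "mesh n"]
      by (simp add: set_integrable_def scaleR_conv_of_real of_real_indicator)
    have t: "(LINT v|lborel. ?i (v - t)) = of_real (mesh n ^ CARD('d))" for t
    proof -
      have "(LINT v|lborel. ?i (v - t)) = (LINT v|lborel. ?i v)"
        using integral_translate[of "\<lambda>v. ?i (v - t)" t] by simp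
      also have "\<dots> = of_real (LINT v|lborel. indicator (cell 0 (mesh n) :: (real ^ 'd) set) v)"
        unfolding integral_complex_of_real[symmetric] by (simp add: of_real_indicator)
      also have "\<dots> = of_real (mesh n ^ CARD('d))"
        using mesh_pos[of n] by (simp add: measure_cell less_imp_le)
      finally show ?thesis .
    qed
    have it: "integrable lborel (\<lambda>v. ?i (v - t))" for t
    proof (rule integrableI_bounded)
      have "(\<integral>\<^sup>+v. ennreal (norm (?i (v - t))) \<partial>lborel) = (\<integral>\<^sup>+v. ennreal (norm (?i v)) \<partial>lborel)"
        using nn_integral_translate[of "\<lambda>v. ennreal (norm (?i (v - t)))" t] by simp
      also have "\<dots> < \<infinity>" using i by (simp add: integrable_iff_bounded)
      finally show "(\<integral>\<^sup>+v. ennreal (norm (?i (v - t))) \<partial>lborel) < \<infinity>" .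
    qed simp
    show ?thesis
      unfolding step_def
      by (subst Bochner_Integration.integral_sum) (simp_all add: it t sum_distrib_left mult.commute)
  qed
  moreover have "(\<lambda>n. LINT v|lborel. step n v) \<longlonglongrightarrow> (LINT v|lborel. g v)"
  proof -
    have "v \<in> cbox (\<chi> j. - R) (\<chi> j. R)" if "g v \<noteq> 0" for v
      using R[OF that] by (auto simp: mem_box_cart abs_le_iff minus_le_iff)
    then obtain M where M: "\<And>v. norm (g v) \<le> M"
      using bounded_compact_supp[OF g, of "\<chi> j. - R" "\<chi> j. R"] by metis
    \<comment> \<open>A corner differs from \<open>v\<close> by at most \<open>mesh n\<close> per
      coordinate, hence by at most one: outside the enlarged box all step functions vanish.\<close>
    let ?w = "\<lambda>v. indicator (cbox (\<chi> j. - (R + 1)) (\<chi> j. R + 1)) v *\<^sub>R M :: real"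
    show ?thesis
    proof (rule integral_dominated_convergence[where w = ?w])
      show "integrable lborel ?w" by (intro borel_integrable_compact) auto
      show "step n \<in> borel_measurable lborel" for n
        unfolding step_def by measurable
      show "AE v in lborel. norm (step n v) \<le> ?w v" for n
      proof (rule AE_I2)
        fix v :: "real ^ 'd"
        show "norm (step n v) \<le> ?w v"
        proof (cases "g (fl n v) = 0")
          case False
          have "\<bar>v $ j\<bar> \<le> R + 1" for j
            using R[OF False, of j] fl[of n v j] mesh_le_1[of n] by linarith
          then have "v \<in> cbox (\<chi> j. - (R + 1)) (\<chi> j. R + 1)"
            by (simp only: mem_box_cart vec_lambda_beta abs_le_iff minus_le_iff) simp
          then show ?thesis using M by (simp add: step_eq)
        next
          case True
          have "0 \<le> M" using norm_ge_zero[of "g v"] M[of v] by linarith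
          with True show ?thesis by (simp add: step_eq indicator_def)
        qed
      qed
      show "AE v in lborel. (\<lambda>n. step n v) \<longlonglongrightarrow> g v"
      proof (rule AE_I2)
        fix v :: "real ^ 'd"
        have "(\<lambda>n. fl n v) \<longlonglongrightarrow> v"
        proof (rule vec_tendstoI)
          fix j
          have "(\<lambda>n. fl n v $ j - v $ j) \<longlonglongrightarrow> 0"
            by (rule Lim_null_comparison[OF _ mesh_tendsto_0]) (simp add: fl)
          then show "(\<lambda>n. fl n v $ j) \<longlonglongrightarrow> v $ j" by (simp add: LIM_zero_iff)
        qed
        then show "(\<lambda>n. step n v) \<longlonglongrightarrow> g v"
          unfolding step_eq using g by (intro isCont_tendsto_compose[of _ g]) (auto simp: continuous_on_eq_continuous_at)
      qed
    qed auto
  qed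
  ultimately show ?thesis by simp
qed

lemma Phi_periodic:
  fixes \<phi> :: "real ^ 'd \<Rightarrow> complex"
  shows "Phi \<phi> \<epsilon> (x + (2 * pi) *\<^sub>R ivec m) = Phi \<phi> \<epsilon> x"
proof -
  have "cis (ivec k \<bullet> (x + (2 * pi) *\<^sub>R ivec m)) = cis (ivec k \<bullet> x)" for k
    using echar_ivec[of k m] by (simp add: echar_def inner_add_right cis_mult[symmetric])
  then show ?thesis by (simp add: Phi_def cis_conv_exp ivec_def)
qed

text \<open>The bound is used for \<open>\<epsilon>\<close> with all entries \<open>mesh n\<close>.
  After rescaling, the integrands \<open>u n\<close> have integrals at most \<open>B\<close> and
  converge pointwise to the transform at the reflected point, up to the constant; Fatou's lemma
  passes the bound to the limit.\<close>

lemma nn_integral_fourier_transform_le: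
  fixes \<phi> :: "real ^ 'd \<Rightarrow> complex"
  assumes p: "0 < p" and \<phi>: "continuous_on UNIV \<phi>" "compact_support \<phi>"
    and [measurable]: "fourier_transform \<phi> \<in> borel_measurable borel"
    and le: "\<And>\<epsilon>. (\<And>j. \<epsilon> $ j \<noteq> 0) \<Longrightarrow>
      ennreal ((\<Prod>j\<in>UNIV. \<bar>\<epsilon> $ j\<bar>) powr (p - 1)) *
        (\<integral>\<^sup>+x\<in>torus_cell. ennreal (norm (Phi \<phi> \<epsilon> x) powr p) \<partial>lborel) \<le> B"
  shows "ennreal (((2 * pi) powr (real CARD('d) / 2)) powr p) *
    (\<integral>\<^sup>+\<xi>. ennreal (norm (fourier_transform \<phi> \<xi>) powr p) \<partial>lborel) \<le> B"
proof -
  define C where "C = (2 * pi) powr (real CARD('d) / 2)"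
  define E where "E n = ((\<chi> j. mesh n) :: real ^ 'd)" for n
  define P where "P n = mesh n ^ CARD('d)" for n
  let ?F = "\<lambda>\<xi>. ennreal (norm (fourier_transform \<phi> \<xi>) powr p)"
  \<comment> \<open>Centred at the origin, so that the rescaled copies of the cell exhaust the whole
    space; with corner \<open>0\<close> they would fill only one orthant.\<close>
  let ?Q = "cell (- pi) (2 * pi) :: (real ^ 'd) set"
  define u where "u n \<xi> = ennreal ((P n * norm (Phi \<phi> (E n) (stretch (E n) \<xi>))) powr p) * indicator ?Q (stretch (E n) \<xi>)"
    for n \<xi>
  have C: "0 < C" by (simp add: C_def)
  have P: "0 < P n" for n by (simp add: P_def mesh_pos)
  have E: "E n $ j \<noteq> 0" for n j using mesh_pos[of n] by (simp add: E_def)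
  have prodE: "(\<Prod>j\<in>UNIV. \<bar>E n $ j\<bar>) = P n" for n
    using mesh_pos[of n] by (simp add: E_def P_def)
  have stretchE: "stretch (E n) v = mesh n *\<^sub>R v" for n v
    by (simp add: vec_eq_iff E_def)
  have [measurable]: "Phi \<phi> (E n) \<in> borel_measurable borel" for n
    by (intro borel_measurable_continuous_onI continuous_Phi \<phi> E)
  have int_u: "(\<integral>\<^sup>+\<xi>. u n \<xi> \<partial>lborel) \<le> B" for n
  proof -
    let ?J = "\<lambda>a. \<integral>\<^sup>+x\<in>cell a (2 * pi). ennreal (norm (Phi \<phi> (E n) x) powr p) \<partial>lborel"
    have "ennreal (P n) * (\<integral>\<^sup>+\<xi>. u n \<xi> \<partial>lborel) =
        (\<integral>\<^sup>+x. ennreal ((P n * norm (Phi \<phi> (E n) x)) powr p) * indicator ?Q x \<partial>lborel)"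
      unfolding u_def prodE[symmetric] by (rule nn_integral_stretch[symmetric]) (auto simp: E)
    also have "\<dots> = (\<integral>\<^sup>+x. ennreal (P n powr p) * (ennreal (norm (Phi \<phi> (E n) x) powr p) * indicator ?Q x) \<partial>lborel)"
      using P[of n] by (intro nn_integral_cong) (simp add: powr_mult ennreal_mult mult.assoc)
    also have "\<dots> = ennreal (P n powr p) * ?J (- pi)"
      by (rule nn_integral_cmult) measurable
    \<comment> \<open>Periodicity of \<open>Phi\<close> exchanges the centred cell for
      \<open>torus_cell\<close>.\<close>
    also have "?J (- pi) = ?J 0"
      using nn_integral_cell_shift[of "2 * pi" "\<lambda>x. ennreal (norm (Phi \<phi> (E n) x) powr p)",
          where t = 0 and a = "- pi" and b = 0]
      by (simp add: Phi_periodic)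
    finally have "ennreal (1 / P n) * (ennreal (P n) * (\<integral>\<^sup>+\<xi>. u n \<xi> \<partial>lborel)) =
        ennreal (1 / P n) * (ennreal (P n powr p) * ?J 0)" by simp
    moreover have "ennreal (1 / P n) * ennreal (P n powr p) = ennreal (P n powr (p - 1))"
      using P[of n] by (simp add: ennreal_mult[symmetric] powr_diff)
    moreover have "ennreal (1 / P n) * ennreal (P n) = 1"
      using P[of n] by (simp add: ennreal_mult[symmetric] less_imp_le)
    ultimately have "(\<integral>\<^sup>+\<xi>. u n \<xi> \<partial>lborel) = ennreal (P n powr (p - 1)) * ?J 0"
      by (simp only: mult.assoc[symmetric] mult_1_left)
    also have "\<dots> \<le> B" using le[of "E n"] E by (simp add: prodE torus_cell_eq)
    finally show ?thesis .
  qed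
  have lim_u: "(\<lambda>n. u n \<xi>) \<longlonglongrightarrow> ennreal ((C * norm (fourier_transform \<phi> (- \<xi>))) powr p)" for \<xi>
  proof -
    let ?g = "\<lambda>v. \<phi> v * cis (v \<bullet> \<xi>)"
    have [measurable]: "\<phi> \<in> borel_measurable borel"
      by (intro borel_measurable_continuous_onI \<phi>)
    obtain R where R: "\<And>v j. \<phi> v \<noteq> 0 \<Longrightarrow> \<bar>v $ j\<bar> \<le> R"
      using compact_support_bound[OF \<phi>(2)] by metis
    have "(\<lambda>n. of_real (P n) * (\<Sum>k | \<phi> (stretch (E n) (ivec k)) \<noteq> 0. ?g (mesh n *\<^sub>R ivec k)))
        \<longlonglongrightarrow> (LINT v|lborel. ?g v)"
      unfolding P_def
      by (rule riemann_sum_tendsto[where R = R])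
        (auto intro!: continuous_intros \<phi> R finite_lattice_support E simp: stretchE[symmetric])
    moreover have "(\<Sum>k | \<phi> (stretch (E n) (ivec k)) \<noteq> 0. ?g (mesh n *\<^sub>R ivec k)) = Phi \<phi> (E n) (stretch (E n) \<xi>)" for n
      unfolding Phi_eq_sum[OF \<phi>(2) E] by (intro sum.cong) (simp_all add: stretchE)
    \<comment> \<open>The dilation rule with all entries one rewrites the integral as a
      transform.\<close>
    moreover have "(LINT v|lborel. ?g v) = of_real C * fourier_transform \<phi> (- \<xi>)"
    proof -
      have "stretch (\<chi> j. 1) v = v" "stretch (\<chi> j. - 1) v = - v" for v :: "real ^ 'd"
        by (simp_all add: vec_eq_iff)
      then show ?thesis
        using fourier_transform_stretch[of \<phi> "\<chi> j. 1" \<xi>] by (simp add: C_def)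
    qed
    ultimately have "(\<lambda>n. of_real (P n) * Phi \<phi> (E n) (stretch (E n) \<xi>)) \<longlonglongrightarrow> of_real C * fourier_transform \<phi> (- \<xi>)"
      by simp
    from tendsto_norm[OF this]
    have "(\<lambda>n. P n * norm (Phi \<phi> (E n) (stretch (E n) \<xi>))) \<longlonglongrightarrow> C * norm (fourier_transform \<phi> (- \<xi>))"
      using P C by (simp add: norm_mult less_imp_le)
    then have l: "(\<lambda>n. ennreal ((P n * norm (Phi \<phi> (E n) (stretch (E n) \<xi>))) powr p))
        \<longlonglongrightarrow> ennreal ((C * norm (fourier_transform \<phi> (- \<xi>))) powr p)"
      using p P by (intro tendsto_ennrealI tendsto_powr') (auto simp: less_imp_le)
    have "\<forall>\<^sub>F n in sequentially. \<bar>mesh n * \<xi> $ j\<bar> < pi" for j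
    proof -
      have "(\<lambda>n. \<bar>mesh n * \<xi> $ j\<bar>) \<longlonglongrightarrow> \<bar>0 * \<xi> $ j\<bar>"
        by (intro tendsto_intros mesh_tendsto_0)
      then show ?thesis by (intro order_tendstoD) auto
    qed
    then have "\<forall>\<^sub>F n in sequentially. \<forall>j. \<bar>mesh n * \<xi> $ j\<bar> < pi"
      by (simp add: eventually_all_finite)
    then have "\<forall>\<^sub>F n in sequentially. ennreal ((P n * norm (Phi \<phi> (E n) (stretch (E n) \<xi>))) powr p) = u n \<xi>"
    proof (rule eventually_mono)
      fix n assume a: "\<forall>j. \<bar>mesh n * \<xi> $ j\<bar> < pi"
      have "- pi \<le> mesh n * \<xi> $ j \<and> mesh n * \<xi> $ j < - pi + 2 * pi" for j
        using a[rule_format, of j] by linarith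
      then have "stretch (E n) \<xi> \<in> ?Q" by (simp add: cell_def stretchE)
      then show "ennreal ((P n * norm (Phi \<phi> (E n) (stretch (E n) \<xi>))) powr p) = u n \<xi>"
        by (simp add: u_def)
    qed
    with l show ?thesis by (rule Lim_transform_eventually)
  qed
  have "(\<integral>\<^sup>+\<xi>. ennreal ((C * norm (fourier_transform \<phi> (- \<xi>))) powr p) \<partial>lborel) =
      (\<integral>\<^sup>+\<xi>. liminf (\<lambda>n. u n \<xi>) \<partial>lborel)"
    using lim_imp_Liminf[OF _ lim_u] by simp
  also have "\<dots> \<le> liminf (\<lambda>n. \<integral>\<^sup>+\<xi>. u n \<xi> \<partial>lborel)"
    by (rule nn_integral_liminf) (simp add: u_def)
  also have "\<dots> \<le> B" by (rule Liminf_le) (auto simp: int_u)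
  finally have "(\<integral>\<^sup>+\<xi>. ennreal ((C * norm (fourier_transform \<phi> (- \<xi>))) powr p) \<partial>lborel) \<le> B" .
  moreover have "ennreal ((C * norm (fourier_transform \<phi> (- \<xi>))) powr p) = ennreal (C powr p) * ?F (- \<xi>)" for \<xi>
    using C by (simp add: powr_mult ennreal_mult)
  \<comment> \<open>Reflection is the dilation with all entries \<open>-1\<close>, of absolute
    determinant one.\<close>
  moreover have "(\<integral>\<^sup>+\<xi>. ?F (- \<xi>) \<partial>lborel) = (\<integral>\<^sup>+\<xi>. ?F \<xi> \<partial>lborel)"
  proof -
    have "stretch (\<chi> j. - 1) v = - v" for v :: "real ^ 'd" by (simp add: vec_eq_iff)
    then show ?thesis by (subst (2) nn_integral_stretch[of "\<chi> j. - 1"]) auto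
  qed
  ultimately show ?thesis by (simp add: nn_integral_cmult C_def[symmetric])
qed

section \<open>The two bounds combined\<close>

theorem theorem2p1:
  fixes p :: real and \<phi> :: "real ^ 'd \<Rightarrow> complex"
  assumes "0 < p" and "p \<le> 1"
    and "continuous_on UNIV \<phi>"
    and "compact_support \<phi>"
    and "in_Lp p UNIV (fourier_transform \<phi>)"
  shows "(SUP \<epsilon> \<in> {\<epsilon> :: real ^ 'd. \<forall>j. \<epsilon> $ j \<noteq> 0}.
            ereal ((\<Prod>j\<in>UNIV. \<bar>\<epsilon> $ j\<bar>) powr (1 - 1 / p) * Lp_norm p torus_cell (Phi \<phi> \<epsilon>)))
         = ereal ((2 * pi) powr (real CARD('d) / 2) * Lp_norm p UNIV (fourier_transform \<phi>))"
proof -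
  note p = assms(1,2) and \<phi> = assms(3,4)
  define C where "C = (2 * pi) powr (real CARD('d) / 2)"
  define P where "P \<epsilon> = (\<Prod>j\<in>UNIV. \<bar>\<epsilon> $ j\<bar>)" for \<epsilon> :: "real ^ 'd"
  define I where "I = (LINT \<xi>|lborel. norm (fourier_transform \<phi> \<xi>) powr p)"
  define J where "J \<epsilon> = (LINT x:torus_cell|lborel. norm (Phi \<phi> \<epsilon> x) powr p)" for \<epsilon>
  let ?D = "{\<epsilon> :: real ^ 'd. \<forall>j. \<epsilon> $ j \<noteq> 0}"
  have C: "0 < C" by (simp add: C_def)
  have P: "0 < P \<epsilon>" if "\<epsilon> \<in> ?D" for \<epsilon> using that by (auto simp: P_def intro!: prod_pos)
  have I0: "0 \<le> I" and J0: "0 \<le> J \<epsilon>" for \<epsilon>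
    by (auto simp: I_def J_def set_lebesgue_integral_def intro!: integral_nonneg_AE)
  have ft [measurable]: "fourier_transform \<phi> \<in> borel_measurable borel"
    and fti: "integrable lborel (\<lambda>\<xi>. norm (fourier_transform \<phi> \<xi>) powr p)"
    using assms(5) by (auto simp: in_Lp_def set_borel_measurable_def set_integrable_def)
  have I_eq: "(\<integral>\<^sup>+\<xi>. ennreal (norm (fourier_transform \<phi> \<xi>) powr p) \<partial>lborel) = ennreal I"
    unfolding I_def by (rule nn_integral_eq_integral[OF fti]) auto
  \<comment> \<open>Continuity of \<open>Phi\<close> makes the integrand integrable on the bounded
    cell, so \<open>J \<epsilon>\<close> is the genuine integral and not a default value.\<close>
  have J_eq: "(\<integral>\<^sup>+x\<in>torus_cell. ennreal (norm (Phi \<phi> \<epsilon> x) powr p) \<partial>lborel) = ennreal (J \<epsilon>)"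
    if "\<epsilon> \<in> ?D" for \<epsilon>
  proof -
    have "set_integrable lborel torus_cell (\<lambda>x. norm (Phi \<phi> \<epsilon> x) powr p)"
      unfolding torus_cell_eq using p that
      by (intro set_integrable_cell continuous_on_powr' continuous_intros continuous_Phi \<phi>) auto
    then show ?thesis
      unfolding J_def set_integrable_def set_lebesgue_integral_def
      by (subst nn_integral_eq_integral[symmetric]) (auto intro!: nn_integral_cong split: split_indicator)
  qed
  \<comment> \<open>Both sides of the theorem are written as \<open>1 / p\<close>-th powers, which
    reduces the comparison to the integrals of \<open>p\<close>-th powers.\<close>
  have term_eq: "P \<epsilon> powr (1 - 1 / p) * Lp_norm p torus_cell (Phi \<phi> \<epsilon>) = (P \<epsilon> powr (p - 1) * J \<epsilon>) powr (1 / p)"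
    if "\<epsilon> \<in> ?D" for \<epsilon>
    using P[OF that] J0 p by (simp add: Lp_norm_def J_def[symmetric] powr_mult powr_powr diff_divide_distrib)
  have rhs_eq: "C * Lp_norm p UNIV (fourier_transform \<phi>) = (C powr p * I) powr (1 / p)"
    using C I0 p by (simp add: Lp_norm_def I_def[symmetric] set_lebesgue_integral_def powr_mult powr_powr)
  have upper: "P \<epsilon> powr (p - 1) * J \<epsilon> \<le> C powr p * I" if "\<epsilon> \<in> ?D" for \<epsilon>
  proof -
    have "ennreal (J \<epsilon>) \<le> ennreal (C powr p * P \<epsilon> powr (1 - p)) * ennreal I"
      using nn_integral_Phi_le[OF p \<phi> _ ft, of \<epsilon>] that
      unfolding J_eq[OF that] I_eq by (simp only: C_def P_def) simp
    then have "J \<epsilon> \<le> C powr p * P \<epsilon> powr (1 - p) * I"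
      using I0 by (simp add: ennreal_mult[symmetric])
    then have "P \<epsilon> powr (p - 1) * J \<epsilon> \<le> P \<epsilon> powr (p - 1) * (C powr p * P \<epsilon> powr (1 - p) * I)"
      by (rule mult_left_mono) simp
    also have "\<dots> = (P \<epsilon> powr (p - 1) * P \<epsilon> powr (1 - p)) * (C powr p * I)" by simp
    also have "P \<epsilon> powr (p - 1) * P \<epsilon> powr (1 - p) = 1"
      using P[OF that] by (simp add: powr_add[symmetric])
    finally show ?thesis by simp
  qed
  have "(SUP \<epsilon> \<in> ?D. ereal (P \<epsilon> powr (1 - 1 / p) * Lp_norm p torus_cell (Phi \<phi> \<epsilon>))) =
      ereal (C * Lp_norm p UNIV (fourier_transform \<phi>))"
  proof (rule SUP_eqI)
    show "ereal (P \<epsilon> powr (1 - 1 / p) * Lp_norm p torus_cell (Phi \<phi> \<epsilon>)) \<le> ereal (C * Lp_norm p UNIV (fourier_transform \<phi>))"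
      if "\<epsilon> \<in> ?D" for \<epsilon>
      using upper[OF that] p J0 unfolding term_eq[OF that] rhs_eq
      by (auto intro!: powr_mono2)
  next
    fix y assume y: "\<And>\<epsilon>. \<epsilon> \<in> ?D \<Longrightarrow> ereal (P \<epsilon> powr (1 - 1 / p) * Lp_norm p torus_cell (Phi \<phi> \<epsilon>)) \<le> y"
    \<comment> \<open>One admissible point shows that the upper bound \<open>y\<close> is not minus
      infinity and, if real, is nonnegative.\<close>
    have D1: "(\<chi> j. 1) \<in> ?D" by simp
    show "ereal (C * Lp_norm p UNIV (fourier_transform \<phi>)) \<le> y"
    proof (cases y)
      case (real r)
      have r: "(P \<epsilon> powr (p - 1) * J \<epsilon>) powr (1 / p) \<le> r" if "\<epsilon> \<in> ?D" for \<epsilon>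
        using y[OF that] unfolding term_eq[OF that] real by simp
      have r0: "0 \<le> r" using r[OF D1] powr_ge_zero order_trans by blast
      have "P \<epsilon> powr (p - 1) * J \<epsilon> \<le> r powr p" if "\<epsilon> \<in> ?D" for \<epsilon>
      proof -
        have "((P \<epsilon> powr (p - 1) * J \<epsilon>) powr (1 / p)) powr p \<le> r powr p"
          using r[OF that] p by (intro powr_mono2) auto
        then show ?thesis using p J0 by (simp add: powr_powr)
      qed
      \<comment> \<open>With \<open>y = r\<close>, the number \<open>r powr p\<close> is the uniform
        bound \<open>B\<close> of the Fatou argument.\<close>
      then have "ennreal (C powr p) * ennreal I \<le> ennreal (r powr p)"
        unfolding I_eq[symmetric] C_def
        by (intro nn_integral_fourier_transform_le p \<phi> ft)
          (auto simp: J_eq P_def[symmetric] ennreal_mult[symmetric] J0 intro!: ennreal_leI)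
      then have "C powr p * I \<le> r powr p"
        using I0 by (simp add: ennreal_mult[symmetric])
      then have "(C powr p * I) powr (1 / p) \<le> (r powr p) powr (1 / p)"
        using p I0 by (intro powr_mono2) auto
      then show ?thesis using p r0 unfolding rhs_eq real by (simp add: powr_powr)
    next
      case MInf
      then show ?thesis using y[OF D1] by simp
    qed simp
  qed
  then show ?thesis by (simp only: P_def C_def)
qed

end
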